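(* Let $y=\mathbf{x}'\beta_0+e$ be a linear regression model, where $\mathbf{x}$ is a random vector in $\mathbb{R}^p$, $\beta_0\in\mathbb{R}^p$, and the error $e$ is independent of $\mathbf{x}$ and is centered and symmetrically distributed with variance $\sigma^2$; let $H_0$ be the joint distribution of $(\mathbf{x},y)$, and let $\lambda\ge0$. Without loss of generality (by ordering the coordinates) let $\beta_{LASSO}(H_0)=((\beta_{LASSO}(H_0))_1,\dots,(\beta_{LASSO}(H_0))_k,0,\dots,0)'$ with $k\le p$ and $(\beta_{LASSO}(H_0))_j\ne0$ for all $j=1,\dots,k$. For $K>1$ let $$\beta_K(H)=\operatorname*{arg\,min}_{\beta\in\mathbb{R}^p}\ \mathbb{E}_{H}\big[(y-\mathbf{x}'\beta)^2\big]+2\lambda\sum_{j=1}^pJ_K(\beta_j),\qquad J_K(t)=t\tanh(Kt).$$ Then, as $K\to\infty$, the influence function $IF((\mathbf{x}_0,y_0),\beta_K,H_0)$ converges to the influence function of the lasso functional, namely $$\begin{pmatrix}\big(\mathbb{E}_{H_0}[\mathbf{x}_{1:k}\mathbf{x}_{1:k}']\big)^{-1}\Big((\mathbf{x}_0)_{1:k}\big(y_0-\mathbf{x}_0'\beta_{LASSO}(H_0)\big)-\mathbb{E}_{H_0}\big[\mathbf{x}_{1:k}(y-\mathbf{x}'\beta_{LASSO}(H_0))\big]\Big)\\ \mathbf{0}_{p-k}\end{pmatrix}.$$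
   Context: For a joint distribution $H$ of $(\mathbf{x},y)\in\mathbb{R}^p\times\mathbb{R}$, the lasso functional is $$\beta_{LASSO}(H)=\operatorname*{arg\,min}_{\beta\in\mathbb{R}^p}\Big(\mathbb{E}_H\big[(y-\mathbf{x}'\beta)^2\big]+2\lambda\sum_{i=1}^p|\beta_i|\Big).$$ The influence function of a functional $\beta(\cdot)$ at a distribution $H$ is $$IF((\mathbf{x}_0,y_0),\beta,H)=\frac{\partial}{\partial\epsilon}\Big[\beta\big((1-\epsilon)H+\epsilon\,\delta_{(\mathbf{x}_0,y_0)}\big)\Big]\Big|_{\epsilon=0},$$ where $\delta_{(\mathbf{x}_0,y_0)}$ is the point mass at $(\mathbf{x}_0,y_0)\in\mathbb{R}^p\times\mathbb{R}$. Notation: $\mathbf{z}_{r:s}=(z_r,z_{r+1},\dots,z_s)'$ for $\mathbf{z}\in\mathbb{R}^p$ and $1\le r\le s\le p$; $\mathbf{0}_{p-k}$ is the zero vector of length $p-k$; a prime on a vector denotes transposition.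
   Formalization: If λ=0, k=p is required (otherwise least squares has nonzero last p-k entries); that the limit is the lasso's own influence function is claimed only if |E[x_j(y-x'β_LASSO)]|<λ for all j>k (with equality it can fail, e.g. p=1, k=0, E[xy]=λ, x_0y_0>λ). *)

theory Defs
  imports "HOL-Probability.Probability"
begin

text \<open>
  Functionals are functions of the joint law \<open>H\<close> of \<open>(x, y)\<close>, a measure on pairs.
  The library's \<open>arg_min\<close> selects some minimizer when there are several; this matters because
  \<open>t * tanh (K * t)\<close> is not convex in \<open>t\<close>.
\<close>

definition penalized_objective ::
    "(real \<Rightarrow> real) \<Rightarrow> real \<Rightarrow> ((real ^ 'p) \<times> real) measure \<Rightarrow> real ^ 'p \<Rightarrow> real" where
  "penalized_objective J lam H \<beta> =
     (\<integral>(x, y). (y - x \<bullet> \<beta>)\<^sup>2 \<partial>H) + 2 * lam * (\<Sum>j\<in>UNIV. J (\<beta> $ j))"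

definition lasso :: "real \<Rightarrow> ((real ^ 'p) \<times> real) measure \<Rightarrow> real ^ 'p" where
  "lasso lam H = arg_min (penalized_objective abs lam H) (\<lambda>_. True)"

definition tanh_penalty :: "real \<Rightarrow> real \<Rightarrow> real" where
  "tanh_penalty K t = t * tanh (K * t)"

definition tanh_lasso :: "real \<Rightarrow> real \<Rightarrow> ((real ^ 'p) \<times> real) measure \<Rightarrow> real ^ 'p" where
  "tanh_lasso K lam H = arg_min (penalized_objective (tanh_penalty K) lam H) (\<lambda>_. True)"

text \<open>The mixture \<open>(1 - \<epsilon>) H + \<epsilon> \<delta>\<^sub>z\<close>, meaningful for \<open>0 \<le> \<epsilon> \<le> 1\<close>.\<close>

definition contaminate :: "real \<Rightarrow> 'b measure \<Rightarrow> 'b \<Rightarrow> 'b measure" where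
  "contaminate \<epsilon> H z = measure_of (space H) (sets H)
     (\<lambda>A. ennreal (1 - \<epsilon>) * emeasure H A + ennreal \<epsilon> * emeasure (return H z) A)"

lemma space_contaminate [simp]: "space (contaminate \<epsilon> H z) = space H"
  by (simp add: contaminate_def)

lemma sets_contaminate [simp, measurable_cong]: "sets (contaminate \<epsilon> H z) = sets H"
  by (simp add: contaminate_def)

lemma emeasure_contaminate:
  assumes "A \<in> sets H"
  shows "emeasure (contaminate \<epsilon> H z) A =
    ennreal (1 - \<epsilon>) * emeasure H A + ennreal \<epsilon> * emeasure (return H z) A"
  unfolding contaminate_def
proof (rule emeasure_measure_of_sigma)
  show "sigma_algebra (space H) (sets H)"
    by (rule sets.sigma_algebra_axioms)
  show "positive (sets H)
     (\<lambda>A. ennreal (1 - \<epsilon>) * emeasure H A + ennreal \<epsilon> * emeasure (return H z) A)"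
    by (simp add: positive_def)
  show "countably_additive (sets H)
     (\<lambda>A. ennreal (1 - \<epsilon>) * emeasure H A + ennreal \<epsilon> * emeasure (return H z) A)"
  proof (rule countably_additiveI)
    fix F :: "nat \<Rightarrow> 'a set"
    assume F: "range F \<subseteq> sets H" "disjoint_family F"
    have "(\<Sum>i. ennreal (1 - \<epsilon>) * emeasure H (F i) + ennreal \<epsilon> * emeasure (return H z) (F i)) =
        ennreal (1 - \<epsilon>) * (\<Sum>i. emeasure H (F i)) + ennreal \<epsilon> * (\<Sum>i. emeasure (return H z) (F i))"
      by (simp add: suminf_add[symmetric] ennreal_suminf_cmult summableI)
    also have "(\<Sum>i. emeasure H (F i)) = emeasure H (\<Union>i. F i)"
      using F by (intro suminf_emeasure)
    also have "(\<Sum>i. emeasure (return H z) (F i)) = emeasure (return H z) (\<Union>i. F i)"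
      using F by (intro suminf_emeasure) auto
    finally show "(\<Sum>i. ennreal (1 - \<epsilon>) * emeasure H (F i) + ennreal \<epsilon> * emeasure (return H z) (F i)) =
        ennreal (1 - \<epsilon>) * emeasure H (\<Union>i. F i) + ennreal \<epsilon> * emeasure (return H z) (\<Union>i. F i)" .
  qed
  show "A \<in> sets H"
    by (rule assms)
qed

lemma contaminate_0: "contaminate 0 H z = H"
  by (rule measure_eqI) (auto simp: emeasure_contaminate)

lemma prob_space_contaminate:
  assumes "prob_space H" "z \<in> space H" "0 \<le> \<epsilon>" "\<epsilon> \<le> 1"
  shows "prob_space (contaminate \<epsilon> H z)"
proof
  have "ennreal (1 - \<epsilon>) + ennreal \<epsilon> = 1"
    using assms by (simp add: ennreal_plus[symmetric] del: ennreal_plus)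
  then show "emeasure (contaminate \<epsilon> H z) (space (contaminate \<epsilon> H z)) = 1"
    using assms by (simp add: emeasure_contaminate prob_space.emeasure_space_1)
qed

text \<open>
  The mixture is a probability measure only for \<open>\<epsilon> \<in> {0..1}\<close>, so the derivative
  at \<open>\<epsilon> = 0\<close> is the right-hand one.
\<close>

definition has_influence_function ::
    "('b measure \<Rightarrow> 'c::real_normed_vector) \<Rightarrow> 'b measure \<Rightarrow> 'b \<Rightarrow> 'c \<Rightarrow> bool" where
  "has_influence_function T H z v \<longleftrightarrow>
     ((\<lambda>\<epsilon>. T (contaminate \<epsilon> H z)) has_vector_derivative v) (at 0 within {0..1})"

definition influence_function ::
    "('b measure \<Rightarrow> 'c::real_normed_vector) \<Rightarrow> 'b measure \<Rightarrow> 'b \<Rightarrow> 'c" where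
  "influence_function T H z =
     vector_derivative (\<lambda>\<epsilon>. T (contaminate \<epsilon> H z)) (at 0 within {0..1})"

text \<open>
  The inverse of a \<open>k \<times> k\<close> matrix with indices \<open>1, \<dots>, k\<close>, analogous to \<open>matrix_inv\<close>; the size
  cannot be a type here because \<open>k\<close> depends on the data and may be \<open>0\<close>.
\<close>

definition inverse_upto :: "nat \<Rightarrow> (nat \<Rightarrow> nat \<Rightarrow> real) \<Rightarrow> nat \<Rightarrow> nat \<Rightarrow> real" where
  "inverse_upto k G = (SOME B. \<forall>i\<in>{1..k}. \<forall>j\<in>{1..k}.
     (\<Sum>l=1..k. G i l * B l j) = (if i = j then 1 else 0) \<and>
     (\<Sum>l=1..k. B i l * G l j) = (if i = j then 1 else 0))"

text \<open>
  \<open>c 1, \<dots>, c p\<close> enumerates the coordinates, so that \<open>z\<^bsub>1:k\<^esub>\<close> has entries \<open>z $ c 1, \<dots>, z $ c k\<close>.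
  The vector below has the block \<open>E[x\<^bsub>1:k\<^esub> x\<^bsub>1:k\<^esub>']\<^sup>-\<^sup>1 (\<dots>)\<close> in the coordinates \<open>c 1, \<dots>, c k\<close> and
  zeros elsewhere; \<open>b\<close> is the lasso coefficient.
\<close>

definition lasso_influence ::
    "(nat \<Rightarrow> 'p) \<Rightarrow> nat \<Rightarrow> ((real ^ 'p) \<times> real) measure \<Rightarrow> real ^ 'p \<Rightarrow> (real ^ 'p) \<times> real \<Rightarrow> real ^ 'p"
  where
  "lasso_influence c k H b z =
     (let G = (\<lambda>i j. \<integral>(x, y). x $ c i * x $ c j \<partial>H);
          w = (\<lambda>l. fst z $ c l * (snd z - fst z \<bullet> b) - (\<integral>(x, y). x $ c l * (y - x \<bullet> b) \<partial>H))
      in \<Sum>i=1..k. (\<Sum>l=1..k. inverse_upto k G i l * w l) *\<^sub>R axis (c i) 1)"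

end

theory Submission
  imports Defs
begin

text \<open>
  Write \<open>A = E[x x']\<close> and \<open>b = E[x y]\<close>. The expected squared error is a convex quadratic in \<open>\<beta>\<close>,
  and contaminating the law at \<open>(a, y\<^sub>0)\<close> keeps it quadratic: half its negative gradient (the score)
  becomes \<open>b - A \<beta> + \<epsilon> W(\<beta>)\<close> with \<open>W(\<beta>) = a (y\<^sub>0 - a \<bullet> \<beta>) - (b - A \<beta>)\<close>. A minimizer for a penalty
  that is differentiable at its coordinates satisfies \<open>score = lam * J'\<close>. Subtracting this equation at
  \<open>\<epsilon> = 0\<close> from the one at \<open>\<epsilon>\<close> gives a linear system for the difference quotient of the minimizers,
  and its limit is
  \<open>(A + lam diag J''(\<beta>\<^sub>K)) h = W(\<beta>\<^sub>K)\<close>. As \<open>K\<close> grows, \<open>J\<^sub>K''\<close> tends to \<open>0\<close> at the active coordinates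
  of the lasso and to \<open>\<infinity>\<close> at the inactive ones, so the limit \<open>h\<close> solves \<open>A h = W\<close> in the active rows
  and vanishes elsewhere. This is the block formula.

  The difficulty is that \<open>J\<^sub>K\<close> is not convex, so that the minimizer must be controlled globally before
  any local argument applies. Uniqueness of the lasso solution does this in three ways.
  It makes the convex lasso objective grow linearly away from the solution (\<open>objective_growth\<close>), which
  gives existence of all minimizers and their convergence; it makes the active block of \<open>A\<close> positive
  definite (\<open>active_block_pd\<close>); and it provides the optimality conditions from which
  \<open>near_optimal_localized\<close> derives that, for large \<open>K\<close>, every nearly optimal point has its inactive
  coordinates in \<open>[-1/K, 1/K]\<close>. On that interval \<open>J\<^sub>K\<close> is convex with curvature of order \<open>K\<close>, even for
  an inactive coordinate whose score equals \<open>lam\<close> in absolute value. Hence the smoothed objective is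
  strongly convex where it matters (\<open>localized_curvature\<close>), and the linear systems can be passed
  to the limit with Cramer's rule (\<open>linear_system_limit\<close>).

  For the lasso functional itself, strict inequalities \<open>\<bar>score\<bar> < lam\<close> at the inactive coordinates
  persist under small contamination and keep these coordinates at \<open>0\<close>. The signs of the active ones
  are locally constant, and the difference quotient solves the same limiting system at once.
\<close>

section \<open>The smoothed absolute value\<close>

definition tanh_penalty_deriv :: "real \<Rightarrow> real \<Rightarrow> real" where
  "tanh_penalty_deriv K t = tanh (K * t) + K * t * (1 - (tanh (K * t))\<^sup>2)"

definition tanh_penalty_deriv2 :: "real \<Rightarrow> real \<Rightarrow> real" where
  "tanh_penalty_deriv2 K t = 2 * K * (1 - (tanh (K * t))\<^sup>2) * (1 - K * t * tanh (K * t))"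

lemma tanh_penalty_deriv:
  "(tanh_penalty K has_real_derivative tanh_penalty_deriv K t) (at t)"
  unfolding tanh_penalty_def [abs_def] tanh_penalty_deriv_def
  by (auto intro!: derivative_eq_intros simp: algebra_simps)

lemma tanh_penalty_deriv2:
  "(tanh_penalty_deriv K has_real_derivative tanh_penalty_deriv2 K t) (at t)"
  unfolding tanh_penalty_deriv_def [abs_def] tanh_penalty_deriv2_def
  by (auto intro!: derivative_eq_intros simp: algebra_simps power2_eq_square)

lemma tanh_mult_self_abs: "s * tanh s = \<bar>s\<bar> * tanh \<bar>s\<bar>" for s :: real
  by (cases "s \<ge> 0") (auto simp: abs_if)

lemma one_minus_tanh: "1 - tanh s = 2 / (exp (2 * s) + 1)" for s :: real
proof -
  define u where "u = exp (2 * s)"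
  have u: "u > 0" "exp (- 2 * s) = 1 / u" by (auto simp: u_def exp_minus divide_inverse)
  show ?thesis
    unfolding tanh_real_altdef u(2) u_def[symmetric] using u(1) by (simp add: divide_simps)
qed

lemma tanh_penalty_abs: "tanh_penalty K t = \<bar>t\<bar> * tanh (K * \<bar>t\<bar>)"
  by (cases "t \<ge> 0") (auto simp: tanh_penalty_def)

lemma tanh_penalty_nonneg: "K > 0 \<Longrightarrow> 0 \<le> tanh_penalty K t"
  unfolding tanh_penalty_abs by (intro mult_nonneg_nonneg) auto

lemma tanh_penalty_le_abs: "tanh_penalty K t \<le> \<bar>t\<bar>"
proof -
  have "\<bar>t * tanh (K * t)\<bar> \<le> \<bar>t\<bar> * 1"
    unfolding abs_mult using tanh_real_bounds[of "K * t"] by (intro mult_left_mono) (auto simp: abs_le_iff)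
  then show ?thesis unfolding tanh_penalty_def by linarith
qed

lemma abs_minus_tanh_penalty:
 "\<bar>t\<bar> - tanh_penalty K t = \<bar>t\<bar> * (2 / (exp (2 * (K * \<bar>t\<bar>)) + 1))"
proof -
  have "\<bar>t\<bar> - tanh_penalty K t = \<bar>t\<bar> * (1 - tanh (K * \<bar>t\<bar>))"
    by (simp add: tanh_penalty_abs right_diff_distrib)
  then show ?thesis by (simp add: one_minus_tanh)
qed

text \<open>
  Since \<open>J\<^sub>K\<close> lies below the absolute value by at most \<open>1/K\<close>, the smoothed objective is uniformly close to
  the lasso objective, and its minimizers are nearly optimal for the lasso.
\<close>

lemma tanh_penalty_ge:
  assumes "K > 0"
  shows "\<bar>t\<bar> - 1 / K \<le> tanh_penalty K t"
proof -
  have e: "1 + 2 * (K * \<bar>t\<bar>) \<le> exp (2 * (K * \<bar>t\<bar>))" by (rule exp_ge_add_one_self)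
  have "K * \<bar>t\<bar> \<ge> 0" using assms by simp
  then have "\<bar>t\<bar> * (2 / (exp (2 * (K * \<bar>t\<bar>)) + 1)) \<le> \<bar>t\<bar> * (2 / (2 * (K * \<bar>t\<bar>) + 2))"
    using e by (intro mult_left_mono frac_le) auto
  also have "\<dots> \<le> 1 / K"
    using assms by (cases "t = 0") (simp_all add: field_simps add_pos_pos)
  finally show ?thesis using abs_minus_tanh_penalty[of t K] by linarith
qed

text \<open>
  Away from \<open>0\<close> the deficit is even of order \<open>1/K\<^sup>2\<close> (in truth exponentially small). Active coordinates
  therefore cannot compensate for a loss of order \<open>1/K\<close> at an inactive one.
\<close>

lemma tanh_penalty_ge_away:
  assumes "K > 0" "t \<noteq> 0"
  shows "\<bar>t\<bar> - 2 / (K\<^sup>2 * \<bar>t\<bar>) \<le> tanh_penalty K t"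
proof -
  let ?s = "K * \<bar>t\<bar>"
  have s: "?s > 0" using assms by simp
  have "?s\<^sup>2 \<le> (1 + ?s)\<^sup>2" using s by (intro power_mono) auto
  also have "\<dots> \<le> (exp ?s)\<^sup>2" using s exp_ge_add_one_self[of ?s] by (intro power_mono) auto
  also have "\<dots> = exp (2 * ?s)" by (simp add: exp_double)
  finally have "\<bar>t\<bar> * (2 / (exp (2 * ?s) + 1)) \<le> \<bar>t\<bar> * (2 / ?s\<^sup>2)"
    using s by (intro mult_left_mono divide_left_mono mult_pos_pos) (auto simp: add_pos_pos)
  also have "\<dots> = 2 / (K\<^sup>2 * \<bar>t\<bar>)"
    using assms by (simp add: power_mult_distrib field_simps power2_eq_square)
  finally show ?thesis using abs_minus_tanh_penalty[of t K] by linarith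
qed

text \<open>
  The least value of \<open>J\<^sub>1''\<close> on \<open>[-1, 1]\<close>. The interval stays clear of the inflection points
  \<open>s tanh s = 1\<close>, that is \<open>\<bar>s\<bar> \<approx> 1.2\<close>, beyond which \<open>J\<^sub>1\<close> is concave.
\<close>

definition central_curvature :: real where
  "central_curvature = 2 * (1 - (tanh 1)\<^sup>2) * (1 - tanh 1)"

lemma central_curvature_pos: "central_curvature > 0"
  unfolding central_curvature_def
  using tanh_real_bounds[of 1] by (intro mult_pos_pos) (auto simp: abs_square_less_1)

lemma tanh_penalty_deriv2_ge_near_0:
  assumes "K > 0" "\<bar>K * t\<bar> \<le> 1"
  shows "central_curvature * K \<le> tanh_penalty_deriv2 K t"
proof -
  let ?s = "\<bar>K * t\<bar>"
  have m: "tanh ?s \<le> tanh 1" "0 \<le> tanh ?s"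
    using assms unfolding tanh_real_le_iff tanh_real_nonneg_iff by auto
  have sq: "(tanh (K * t))\<^sup>2 = (tanh ?s)\<^sup>2" by (cases "K * t \<ge> 0") (auto simp: abs_if)
  have b: "tanh (1::real) < 1" "0 < tanh (1::real)" using tanh_real_bounds[of 1] by auto
  have "?s * tanh ?s \<le> 1 * tanh 1" using m assms by (intro mult_mono) auto
  moreover have "(tanh ?s)\<^sup>2 \<le> (tanh 1)\<^sup>2" using m by (intro power_mono) auto
  moreover have "(tanh (1::real))\<^sup>2 \<le> 1" using b by (auto simp: abs_square_le_1)
  ultimately have "(1 - (tanh 1)\<^sup>2) * (1 - tanh 1) \<le> (1 - (tanh ?s)\<^sup>2) * (1 - ?s * tanh ?s)"
    using b by (intro mult_mono) auto
  then have "2 * K * ((1 - (tanh 1)\<^sup>2) * (1 - tanh 1)) \<le> 2 * K * ((1 - (tanh ?s)\<^sup>2) * (1 - ?s * tanh ?s))"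
    using assms by (intro mult_left_mono) auto
  then show ?thesis
    unfolding tanh_penalty_deriv2_def central_curvature_def sq tanh_mult_self_abs[of "K * t"]
    by (simp only: mult_ac)
qed

lemma tanh_penalty_deriv2_away:
  assumes "K > 0" "t \<noteq> 0"
  shows "\<bar>tanh_penalty_deriv2 K t\<bar> \<le> 27 / (K * t\<^sup>2)"
proof -
  let ?s = "\<bar>K * t\<bar>"
  have s: "?s > 0" using assms by simp
  have sq: "(tanh (K * t))\<^sup>2 = (tanh ?s)\<^sup>2" by (cases "K * t \<ge> 0") (auto simp: abs_if)
  have th: "0 < tanh ?s" "tanh ?s < 1" using s tanh_real_bounds[of ?s] by auto
  have pos: "exp (2 * ?s) + 1 > 0" by (simp add: add_pos_pos)
  have "u\<^sup>2 * (1 + u) \<le> 27 / 8 * (1 + 2 * u / 3) ^ 3" if "u > 0" for u :: real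
  proof -
    have "27 / 8 * (1 + 2 * u / 3) ^ 3 = 27 / 8 + 27 / 4 * u + 9 / 2 * u\<^sup>2 + u ^ 3"
      by (simp add: power2_eq_square power3_eq_cube field_simps)
    moreover have "0 \<le> u\<^sup>2" by simp
    moreover have "u\<^sup>2 * (1 + u) = u\<^sup>2 + u ^ 3" by (simp add: power2_eq_square power3_eq_cube algebra_simps)
    ultimately show ?thesis using that by linarith
  qed
  from this[OF s] have "?s\<^sup>2 * (1 + ?s) \<le> 27 / 8 * (1 + 2 * ?s / 3) ^ 3" .
  also have "\<dots> \<le> 27 / 8 * exp (2 * ?s)"
    using exp_ge_one_plus_x_over_n_power_n[of 3 "2 * ?s"] s by simp
  finally have e: "?s\<^sup>2 * (1 + ?s) \<le> 27 / 8 * (exp (2 * ?s) + 1)" by simp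
  have "\<bar>1 - ?s * tanh ?s\<bar> \<le> 1 + ?s"
  proof -
    have "?s * tanh ?s \<le> ?s * 1" "0 \<le> ?s * tanh ?s" using s th by (auto intro!: mult_left_mono)
    then show ?thesis by linarith
  qed
  moreover have "(1 - (tanh ?s)\<^sup>2) \<le> 2 * (2 / (exp (2 * ?s) + 1))"
  proof -
    have "1 - (tanh ?s)\<^sup>2 = (1 + tanh ?s) * (1 - tanh ?s)" by (simp add: power2_eq_square algebra_simps)
    also have "\<dots> \<le> 2 * (1 - tanh ?s)" using th by (intro mult_right_mono) auto
    finally show ?thesis unfolding one_minus_tanh .
  qed
  moreover have "0 \<le> 1 - (tanh ?s)\<^sup>2" using th by (simp add: abs_square_le_1)
  ultimately have "(1 - (tanh ?s)\<^sup>2) * \<bar>1 - ?s * tanh ?s\<bar> \<le> 2 * (2 / (exp (2 * ?s) + 1)) * (1 + ?s)"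
    using pos by (intro mult_mono) auto
  also have "\<dots> \<le> 27 / 2 / ?s\<^sup>2"
    using e s pos by (simp add: field_simps)
  finally have *: "(1 - (tanh ?s)\<^sup>2) * \<bar>1 - ?s * tanh ?s\<bar> \<le> 27 / 2 / ?s\<^sup>2" .
  have "\<bar>tanh_penalty_deriv2 K t\<bar> = 2 * K * ((1 - (tanh ?s)\<^sup>2) * \<bar>1 - ?s * tanh ?s\<bar>)"
    unfolding tanh_penalty_deriv2_def sq tanh_mult_self_abs[of "K * t"]
    using assms \<open>0 \<le> 1 - (tanh ?s)\<^sup>2\<close> by (simp add: abs_mult)
  also have "\<dots> \<le> 2 * K * (27 / 2 / ?s\<^sup>2)" using * assms by (intro mult_left_mono) auto
  also have "\<dots> = 27 / (K * t\<^sup>2)" using assms by (simp add: power_mult_distrib field_simps power2_eq_square)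
  finally show ?thesis .
qed

text \<open>
  The function \<open>s (1 - tanh s) = 2 s / (exp (2 s) + 1)\<close> has its maximum near \<open>0.64\<close> and decreases afterwards.
  Its value at \<open>1/2\<close>, namely \<open>1 / (e + 1)\<close>, exceeds all values on \<open>[1, \<infinity>)\<close> by a margin, because
  \<open>exp (2 s) \<ge> e\<^sup>2 (2 s - 1)\<close> there.
\<close>

lemma mult_tanh_gap_at_1:
  fixes s :: real
  assumes "s \<ge> 1"
  shows "s * (1 - tanh s) + 1 / 50 \<le> 1 / 2 * (1 - tanh (1 / 2))"
proof -
  define E where "E = exp (1::real)"
  have "inverse (2 ^ 32 :: real) \<le> 1 / 1000" by simp
  then have "exp (1::real) \<ge> 27 / 10" using e_approx_32 by linarith
  then have E: "E \<ge> 27 / 10" "E \<le> 3"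
    using exp_le by (auto simp: E_def)
  have "E\<^sup>2 * (2 * s - 1) \<le> exp (2 * s)"
  proof -
    have "1 + (2 * s - 2) \<le> exp (2 * s - 2)" by (rule exp_ge_add_one_self)
    then have "E\<^sup>2 * (2 * s - 1) \<le> E\<^sup>2 * exp (2 * s - 2)" by (intro mult_left_mono) auto
    also have "\<dots> = exp (2 * s)" by (simp add: E_def exp_diff exp_double[symmetric])
    finally show ?thesis .
  qed
  moreover have "11 / 10 * (E + 1) * (2 * s) \<le> E\<^sup>2 * (2 * s - 1) + 1"
  proof -
    have "27 / 10 * E \<le> E * E" using E by (intro mult_right_mono) auto
    then have "27 / 10 * E \<le> E\<^sup>2" by (simp only: power2_eq_square)
    moreover have "22 / 10 * (E + 1) \<le> 27 / 10 * E + 1" "11 / 10 * (E + 1) \<le> 27 / 10 * E"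
      using E by simp_all
    ultimately have a: "22 / 10 * (E + 1) \<le> E\<^sup>2 + 1" "11 / 10 * (E + 1) \<le> E\<^sup>2" by simp_all
    have "11 / 10 * (E + 1) * (2 * s - 2) \<le> E\<^sup>2 * (2 * s - 2)"
      using a(2) assms by (intro mult_right_mono) auto
    moreover have "11 / 10 * (E + 1) * (2 * s) = 11 / 10 * (E + 1) * (2 * s - 2) + 22 / 10 * (E + 1)"
      "E\<^sup>2 * (2 * s - 1) + 1 = E\<^sup>2 * (2 * s - 2) + (E\<^sup>2 + 1)"
      by (simp_all add: field_simps)
    ultimately show ?thesis using a(1) by linarith
  qed
  ultimately have "11 / 10 * (E + 1) * (2 * s) \<le> exp (2 * s) + 1" by linarith
  then have "s * (2 / (exp (2 * s) + 1)) \<le> 10 / 11 * (1 / (E + 1))"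
    using E by (simp add: field_simps add_pos_pos)
  moreover have "1 / 4 \<le> 1 / (E + 1)" using E by (simp add: field_simps)
  ultimately have "s * (2 / (exp (2 * s) + 1)) + 1 / 50 \<le> 1 / (E + 1)" by linarith
  then show ?thesis by (simp add: one_minus_tanh E_def)
qed

text \<open>
  At scale \<open>s = K t\<close> an inactive coordinate with score \<open>r\<close> contributes \<open>l s tanh s - r s\<close> to the objective, up to
  the factor \<open>2/K\<close>, with \<open>l = lam\<close>. For \<open>\<bar>r\<bar> < l\<close> it is clear that large \<open>s\<close> is bad. The point is the boundary
  case \<open>\<bar>r\<bar> = l\<close>: as \<open>s\<close> goes to infinity in the direction of \<open>r\<close>, the expression only tends to \<open>0\<close>, but it is
  lower by a fixed multiple of \<open>l\<close> at distance \<open>1/2\<close> from \<open>0\<close> in this direction. That case is also the worst one, so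
  the gap is uniform in \<open>r\<close>.
\<close>

lemma mult_tanh_gap:
  fixes r l :: real
  assumes "\<bar>r\<bar> \<le> l"
  obtains s' where "\<bar>s'\<bar> \<le> 1"
    "\<And>s. \<bar>s\<bar> \<ge> 1 \<Longrightarrow> l * (s' * tanh s') - r * s' + l / 50 \<le> l * (s * tanh s) - r * s"
proof
  let ?s' = "if r \<ge> 0 then 1 / 2 else - 1 / 2 :: real"
  show "\<bar>?s'\<bar> \<le> 1" by auto
  fix s :: real assume s: "\<bar>s\<bar> \<ge> 1"
  let ?u = "\<bar>s\<bar>"
  have l: "l \<ge> 0" using assms by linarith
  have "l * (?u * (1 - tanh ?u) + 1 / 50) \<le> l * (1 / 2 * (1 - tanh (1 / 2)))"
    using mult_tanh_gap_at_1[OF s] l by (intro mult_left_mono) auto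
  then have "l * (1 / 2 * tanh (1 / 2)) + l / 50 \<le> l * (?u * tanh ?u) - l * (?u - 1 / 2)"
    by (simp add: algebra_simps)
  also have "\<dots> \<le> l * (?u * tanh ?u) - \<bar>r\<bar> * (?u - 1 / 2)"
    using assms s by (simp add: mult_right_mono)
  also have "\<dots> \<le> l * (s * tanh s) - r * s + \<bar>r\<bar> / 2"
  proof -
    have "r * s \<le> \<bar>r\<bar> * ?u" by (metis abs_ge_self abs_mult)
    then show ?thesis by (simp add: tanh_mult_self_abs[of s] algebra_simps)
  qed
  finally show "l * (?s' * tanh ?s') - r * ?s' + l / 50 \<le> l * (s * tanh s) - r * s"
    by (auto simp: algebra_simps split: if_splits)
qed

section \<open>Limits of linear systems\<close>

lemma invertible_if_trivial_kernel:
  fixes L :: "real ^ 'n ^ 'n"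
  assumes "\<And>v. L *v v = 0 \<Longrightarrow> v = 0"
  shows "invertible L"
  using assms by (auto simp: invertible_left_inverse matrix_left_invertible_ker)

text \<open>
  By Cramer's rule the solution is a quotient of polynomials in the coefficients, hence continuous where the
  limiting determinant is not \<open>0\<close>.
\<close>

lemma linear_system_limit:
  fixes L :: "real ^ 'n ^ 'n" and M :: "'i \<Rightarrow> real ^ 'n ^ 'n"
  assumes M: "\<And>i j. ((\<lambda>x. M x $ i $ j) \<longlongrightarrow> L $ i $ j) F"
    and ker: "\<And>v. L *v v = 0 \<Longrightarrow> v = 0"
    and w: "(w \<longlongrightarrow> L *v h) F"
    and sol: "\<forall>\<^sub>F x in F. M x *v v x = w x"
  shows "(v \<longlongrightarrow> h) F"
proof -
  have dL: "det L \<noteq> 0"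
    using invertible_if_trivial_kernel[OF ker] by (simp add: invertible_det_nz)
  have dM: "((\<lambda>x. det (M x)) \<longlongrightarrow> det L) F"
    unfolding det_def by (intro tendsto_intros M)
  then have nz: "\<forall>\<^sub>F x in F. det (M x) \<noteq> 0"
    using dL by (rule tendsto_imp_eventually_ne)
  define cr where "cr N u = (\<chi> k. det (\<chi> i j. if j = k then u $ i else N $ i $ j) / det N)"
    for N :: "real ^ 'n ^ 'n" and u :: "real ^ 'n"
  have "((\<lambda>x. cr (M x) (w x)) \<longlongrightarrow> cr L (L *v h)) F"
  proof (rule vec_tendstoI)
    fix k
    have "((\<lambda>x. det (\<chi> i j. if j = k then w x $ i else M x $ i $ j)) \<longlongrightarrow>
      det (\<chi> i j. if j = k then (L *v h) $ i else L $ i $ j)) F"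
      unfolding det_def
    proof (intro tendsto_sum tendsto_mult tendsto_const tendsto_prod)
      fix p i
      show "((\<lambda>x. (\<chi> i j. if j = k then w x $ i else M x $ i $ j) $ i $ p i) \<longlongrightarrow>
         (\<chi> i j. if j = k then (L *v h) $ i else L $ i $ j) $ i $ p i) F"
        using M[of i "p i"] tendsto_vec_nth[OF w, of i] by (cases "p i = k") simp_all
    qed
    from tendsto_divide[OF this dM dL] show "((\<lambda>x. cr (M x) (w x) $ k) \<longlongrightarrow> cr L (L *v h) $ k) F"
      unfolding cr_def by simp
  qed
  moreover have "cr L (L *v h) = h"
    using cramer[OF dL, of h "L *v h"] by (simp add: cr_def)
  moreover have "\<forall>\<^sub>F x in F. cr (M x) (w x) = v x"
    using nz sol
  proof eventually_elim
    case (elim x)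
    then show ?case using cramer[OF elim(1), of "v x" "w x"] by (simp add: cr_def)
  qed
  ultimately show ?thesis
    using Lim_transform_eventually by fastforce
qed

lemma matrix_vector_bound:
  fixes A :: "real ^ 'n ^ 'm"
  obtains B where "B > 0" "\<And>v. norm (A *v v) \<le> B * norm v"
proof -
  obtain B where "B > 0" "\<And>v. norm (A *v v) \<le> norm v * B"
    using bounded_linear.pos_bounded[OF matrix_vector_mul_bounded_linear[of A]] by blast
  then show ?thesis using that by (simp add: mult.commute)
qed

lemma norm_sq_eq_sum: "(norm v)\<^sup>2 = (\<Sum>j\<in>UNIV. (v $ j)\<^sup>2)" for v :: "real ^ 'n"
  by (simp only: power2_norm_eq_inner inner_vec_def) (simp add: power2_eq_square)

section \<open>The contaminated penalized loss\<close>

text \<open>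
  The parameters stand for the moments \<open>A = E[x x']\<close>, \<open>b = E[x y]\<close>, \<open>\<kappa> = E[y\<^sup>2]\<close> and the
  contamination point \<open>(a, y\<^sub>0)\<close>.
\<close>

locale contaminated_loss =
  fixes A :: "real ^ 'p ^ 'p" and b :: "real ^ 'p" and \<kappa> lam :: real
    and a :: "real ^ 'p" and y\<^sub>0 :: real
  assumes A_sym: "v \<bullet> (A *v w) = w \<bullet> (A *v v)"
    and A_psd: "0 \<le> v \<bullet> (A *v v)"
    and lam_nonneg: "0 \<le> lam"
begin

definition loss :: "real \<Rightarrow> real ^ 'p \<Rightarrow> real" where
  "loss \<epsilon> \<beta> = (1 - \<epsilon>) * (\<beta> \<bullet> (A *v \<beta>) - 2 * (b \<bullet> \<beta>) + \<kappa>) + \<epsilon> * (y\<^sub>0 - a \<bullet> \<beta>)\<^sup>2"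

definition objective :: "real \<Rightarrow> (real \<Rightarrow> real) \<Rightarrow> real ^ 'p \<Rightarrow> real" where
  "objective \<epsilon> J \<beta> = loss \<epsilon> \<beta> + 2 * lam * (\<Sum>j\<in>UNIV. J (\<beta> $ j))"

text \<open>
  The derivative in \<open>\<epsilon>\<close> of the score below, and so the right-hand side of every linear system for
  an influence function.
\<close>

definition score_shift :: "real ^ 'p \<Rightarrow> real ^ 'p" where
  "score_shift \<beta> = (y\<^sub>0 - a \<bullet> \<beta>) *\<^sub>R a - (b - A *v \<beta>)"

text \<open>
  Minus half the gradient of \<open>loss \<epsilon>\<close>.
\<close>

definition score :: "real \<Rightarrow> real ^ 'p \<Rightarrow> real ^ 'p" where
  "score \<epsilon> \<beta> = (b - A *v \<beta>) + \<epsilon> *\<^sub>R score_shift \<beta>"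

lemma loss_add:
  "loss \<epsilon> (\<beta> + h) =
     loss \<epsilon> \<beta> - 2 * (score \<epsilon> \<beta> \<bullet> h) + ((1 - \<epsilon>) * (h \<bullet> (A *v h)) + \<epsilon> * (a \<bullet> h)\<^sup>2)"
proof -
  have "\<beta> \<bullet> (A *v h) = h \<bullet> (A *v \<beta>)" by (rule A_sym)
  then show ?thesis
    unfolding loss_def score_def score_shift_def
    by (simp add: matrix_vector_right_distrib inner_simps inner_commute power2_eq_square algebra_simps)
qed

lemma score_diff: "score \<epsilon> x - score 0 x' = \<epsilon> *\<^sub>R score_shift x - A *v (x - x')"
  by (simp add: score_def matrix_vector_mult_diff_distrib)

lemma continuous_on_score_shift: "continuous_on UNIV score_shift"
  unfolding score_shift_def [abs_def]
  by (intro continuous_intros linear_continuous_on matrix_vector_mul_bounded_linear)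

text \<open>
  The score shift is affine; in this form it bounds the shift at an unknown minimizer by the
  shift at a known one.
\<close>

lemma score_shift_lipschitz:
  obtains B where "B > 0" "\<And>x x'. norm (score_shift x) \<le> norm (score_shift x') + B * norm (x - x')"
proof -
  obtain B where B: "B > 0" "\<And>v. norm (A *v v) \<le> B * norm v" by (rule matrix_vector_bound[of A]) blast
  have "norm (score_shift x) \<le> norm (score_shift x') + (B + norm a * norm a) * norm (x - x')" for x x'
  proof -
    have "score_shift x = score_shift x' + (A *v (x - x') - (a \<bullet> (x - x')) *\<^sub>R a)"
      by (simp add: score_shift_def matrix_vector_mult_diff_distrib inner_diff_right scaleR_left_diff_distrib)
    then have "norm (score_shift x) \<le> norm (score_shift x') + (norm (A *v (x - x')) + norm ((a \<bullet> (x - x')) *\<^sub>R a))"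
      using norm_triangle_ineq[of "score_shift x'" "A *v (x - x') - (a \<bullet> (x - x')) *\<^sub>R a"]
        norm_triangle_ineq4[of "A *v (x - x')" "(a \<bullet> (x - x')) *\<^sub>R a"] by simp
    moreover have "norm ((a \<bullet> (x - x')) *\<^sub>R a) \<le> norm a * norm (x - x') * norm a"
      by (simp add: Cauchy_Schwarz_ineq2 mult_right_mono)
    ultimately show ?thesis using B(2)[of "x - x'"] by (simp add: algebra_simps)
  qed
  moreover have "B + norm a * norm a > 0" using B(1) by (simp add: add_pos_nonneg)
  ultimately show ?thesis using that by blast
qed

lemma continuous_on_loss: "continuous_on UNIV (loss \<epsilon>)"
  unfolding loss_def [abs_def]
  by (intro continuous_intros linear_continuous_on matrix_vector_mul_bounded_linear)

lemma continuous_on_objective: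
  assumes "continuous_on UNIV J"
  shows "continuous_on UNIV (objective \<epsilon> J)"
  unfolding objective_def [abs_def]
  by (intro continuous_intros continuous_on_loss continuous_on_compose2[OF assms]) auto

lemma objective_mixture:
  "objective \<epsilon> J \<beta> = (1 - \<epsilon>) * objective 0 J \<beta>
     + \<epsilon> * ((y\<^sub>0 - a \<bullet> \<beta>)\<^sup>2 + 2 * lam * (\<Sum>j\<in>UNIV. J (\<beta> $ j)))"
  by (simp add: objective_def loss_def algebra_simps)

lemma objective_ge:
  assumes "0 \<le> \<epsilon>" "\<And>t. 0 \<le> J t"
  shows "(1 - \<epsilon>) * objective 0 J \<beta> \<le> objective \<epsilon> J \<beta>"
  using assms lam_nonneg by (subst (2) objective_mixture) (auto intro!: mult_nonneg_nonneg add_nonneg_nonneg sum_nonneg)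

lemma objective_mono:
  assumes "\<And>t. J t \<le> J' t"
  shows "objective \<epsilon> J \<beta> \<le> objective \<epsilon> J' \<beta>"
  unfolding objective_def using assms lam_nonneg by (auto intro!: mult_left_mono sum_mono)

lemma objective_abs_le:
  assumes "\<And>t. \<bar>t\<bar> - C \<le> J t"
  shows "objective \<epsilon> abs \<beta> \<le> objective \<epsilon> J \<beta> + 2 * lam * (real CARD('p) * C)"
proof -
  have "(\<Sum>j\<in>UNIV. \<bar>\<beta> $ j\<bar>) \<le> (\<Sum>j\<in>UNIV. J (\<beta> $ j) + C)"
    using assms by (intro sum_mono) (smt (verit))
  then have "(\<Sum>j\<in>UNIV. \<bar>\<beta> $ j\<bar>) \<le> (\<Sum>j\<in>UNIV. J (\<beta> $ j)) + real CARD('p) * C"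
    by (simp add: sum.distrib)
  then have "2 * lam * (\<Sum>j\<in>UNIV. \<bar>\<beta> $ j\<bar>) \<le> 2 * lam * ((\<Sum>j\<in>UNIV. J (\<beta> $ j)) + real CARD('p) * C)"
    using lam_nonneg by (intro mult_left_mono) auto
  then show ?thesis unfolding objective_def by (simp add: algebra_simps)
qed

text \<open>
  The contaminated objective dominates \<open>1 - \<epsilon>\<close> times the uncontaminated one, and at a fixed point \<open>z\<close>
  exceeds it by \<open>O(\<epsilon>)\<close> only. A minimizer under contamination is thus nearly optimal without it,
  which allows all global arguments to be carried out at \<open>\<epsilon> = 0\<close>.
\<close>

lemma minimizer_contaminated_near_optimal:
  assumes min: "\<And>z. objective \<epsilon> J x \<le> objective \<epsilon> J z"
    and J: "\<And>t. 0 \<le> J t" and eps: "0 \<le> \<epsilon>" "\<epsilon> \<le> 1 / 2"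
  shows "objective 0 J x \<le> objective 0 J z
           + 2 * \<epsilon> * ((y\<^sub>0 - a \<bullet> z)\<^sup>2 + 2 * lam * (\<Sum>j\<in>UNIV. J (z $ j)))"
proof -
  define E where "E = (y\<^sub>0 - a \<bullet> z)\<^sup>2 + 2 * lam * (\<Sum>j\<in>UNIV. J (z $ j))"
  have E: "E \<ge> 0" unfolding E_def using J lam_nonneg by (auto intro!: add_nonneg_nonneg mult_nonneg_nonneg sum_nonneg)
  have "(1 - \<epsilon>) * objective 0 J x \<le> objective \<epsilon> J x" using eps J by (intro objective_ge) auto
  also have "\<dots> \<le> (1 - \<epsilon>) * objective 0 J z + \<epsilon> * E"
    using min[of z] by (subst (asm) (2) objective_mixture) (simp add: E_def)
  also have "\<dots> \<le> (1 - \<epsilon>) * objective 0 J z + (1 - \<epsilon>) * (2 * \<epsilon> * E)"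
  proof -
    have "\<epsilon> * E * 1 \<le> \<epsilon> * E * (2 * (1 - \<epsilon>))" using eps E by (intro mult_left_mono) auto
    then show ?thesis by (simp add: algebra_simps)
  qed
  also have "\<dots> = (1 - \<epsilon>) * (objective 0 J z + 2 * \<epsilon> * E)" by (simp add: algebra_simps)
  finally show ?thesis using eps unfolding E_def by (subst (asm) mult_le_cancel_left_pos) auto
qed

lemma objective_along_axis:
  "objective \<epsilon> J (\<beta> + t *\<^sub>R axis j 1) =
     objective \<epsilon> J \<beta> - 2 * t * score \<epsilon> \<beta> $ j
      + t\<^sup>2 * ((1 - \<epsilon>) * A $ j $ j + \<epsilon> * (a $ j)\<^sup>2)
      + 2 * lam * (J (\<beta> $ j + t) - J (\<beta> $ j))"
proof -
  have "(\<Sum>i\<in>UNIV. J ((\<beta> + t *\<^sub>R axis j 1) $ i)) = J (\<beta> $ j + t) + (\<Sum>i\<in>UNIV - {j}. J (\<beta> $ i))"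
    by (subst sum.remove[of _ j]) (auto simp: axis_def intro!: sum.cong)
  moreover have "(\<Sum>i\<in>UNIV. J (\<beta> $ i)) = J (\<beta> $ j) + (\<Sum>i\<in>UNIV - {j}. J (\<beta> $ i))"
    by (subst sum.remove[of _ j]) auto
  moreover define h where "h = t *\<^sub>R axis j (1::real)"
  have "axis j 1 \<bullet> (A *v axis j 1) = A $ j $ j"
    by (simp add: inner_axis' matrix_vector_mul_component inner_axis)
  then have "h \<bullet> (A *v h) = t\<^sup>2 * A $ j $ j"
    by (simp add: h_def matrix_vector_mult_scaleR power2_eq_square)
  moreover have "a \<bullet> h = t * a $ j" "score \<epsilon> \<beta> \<bullet> h = t * score \<epsilon> \<beta> $ j"
    by (simp_all add: h_def inner_axis)
  ultimately show ?thesis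
    unfolding objective_def h_def[symmetric] loss_add by (simp add: algebra_simps power_mult_distrib)
qed

lemma stationary:
  assumes min: "\<And>z. objective \<epsilon> J x \<le> objective \<epsilon> J z"
    and D: "(J has_real_derivative D) (at (x $ j))"
  shows "score \<epsilon> x $ j = lam * D"
proof -
  define q where "q = (1 - \<epsilon>) * A $ j $ j + \<epsilon> * (a $ j)\<^sup>2"
  let ?g = "\<lambda>t. objective \<epsilon> J x - 2 * t * score \<epsilon> x $ j + t\<^sup>2 * q
      + 2 * lam * (J (x $ j + t) - J (x $ j))"
  have "((\<lambda>t. J (x $ j + t)) has_real_derivative D) (at 0)"
    using DERIV_shift[of J D 0 "x $ j"] D by (simp add: add.commute)
  then have "(?g has_real_derivative (- 2 * score \<epsilon> x $ j + 2 * lam * D)) (at 0)"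
    by (auto intro!: derivative_eq_intros)
  moreover have "\<forall>t. \<bar>0 - t\<bar> < 1 \<longrightarrow> ?g 0 \<le> ?g t"
  proof (intro allI impI)
    fix t
    have "objective \<epsilon> J x \<le> objective \<epsilon> J (x + t *\<^sub>R axis j 1)" by (rule min)
    then show "?g 0 \<le> ?g t" unfolding objective_along_axis q_def by simp
  qed
  ultimately have "- 2 * score \<epsilon> x $ j + 2 * lam * D = 0"
    by (intro DERIV_local_min[where d = 1 and f = ?g and x = 0]) auto
  then show ?thesis by simp
qed

end

section \<open>Geometry of a unique lasso solution\<close>

lemma has_real_derivative_abs:
  assumes "t \<noteq> 0"
  shows "(abs has_real_derivative sgn t) (at t)"
  using GDERIV_norm[OF assms] by (simp add: gderiv_deriv real_norm_def[abs_def])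

text \<open>
  A coordinate \<open>j\<close> is called active if \<open>\<beta>s $ j \<noteq> 0\<close>. The curvature that keeps inactive coordinates of the smoothed
  minimizers near \<open>0\<close> carries the factor \<open>lam\<close>, so inactive coordinates can be allowed only under a
  positive penalty.
\<close>

locale unique_lasso = contaminated_loss A b \<kappa> lam a y\<^sub>0
  for A :: "real ^ 'p ^ 'p" and b \<kappa> lam a y\<^sub>0 +
  fixes \<beta>s :: "real ^ 'p"
  assumes unique: "\<beta> \<noteq> \<beta>s \<Longrightarrow> objective 0 abs \<beta>s < objective 0 abs \<beta>"
    and active_if_unpenalized: "lam = 0 \<Longrightarrow> \<beta>s $ j \<noteq> 0"
begin

lemma lasso_optimal: "objective 0 abs \<beta>s \<le> objective 0 abs \<beta>"
  using unique[of \<beta>] by (cases "\<beta> = \<beta>s") auto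

lemma objective_segment_convex:
  assumes "0 \<le> t" "t \<le> 1"
  shows "objective 0 abs (\<beta>s + t *\<^sub>R (\<beta> - \<beta>s))
           \<le> (1 - t) * objective 0 abs \<beta>s + t * objective 0 abs \<beta>"
proof -
  define h where "h = \<beta> - \<beta>s"
  have q: "t\<^sup>2 * (h \<bullet> (A *v h)) \<le> t * (h \<bullet> (A *v h))"
    using assms A_psd[of h] by (intro mult_right_mono) (auto simp: power2_eq_square mult_left_le)
  have 1: "loss 0 (\<beta>s + t *\<^sub>R h) = loss 0 \<beta>s - 2 * t * (score 0 \<beta>s \<bullet> h) + t\<^sup>2 * (h \<bullet> (A *v h))"
    unfolding loss_add by (simp add: matrix_vector_mult_scaleR power2_eq_square)
  have 2: "loss 0 (\<beta>s + h) = loss 0 \<beta>s - 2 * (score 0 \<beta>s \<bullet> h) + h \<bullet> (A *v h)"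
    unfolding loss_add by simp
  have L: "loss 0 (\<beta>s + t *\<^sub>R h) \<le> (1 - t) * loss 0 \<beta>s + t * loss 0 (\<beta>s + h)"
    unfolding 1 2 using q by (simp add: algebra_simps)
  have "\<bar>(\<beta>s + t *\<^sub>R h) $ j\<bar> \<le> (1 - t) * \<bar>\<beta>s $ j\<bar> + t * \<bar>(\<beta>s + h) $ j\<bar>" for j
  proof -
    have "(\<beta>s + t *\<^sub>R h) $ j = (1 - t) * \<beta>s $ j + t * (\<beta>s + h) $ j"
      by (simp add: algebra_simps)
    also have "\<bar>\<dots>\<bar> \<le> \<bar>(1 - t) * \<beta>s $ j\<bar> + \<bar>t * (\<beta>s + h) $ j\<bar>" by (rule abs_triangle_ineq)
    finally show ?thesis using assms by (simp add: abs_mult)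
  qed
  then have "(\<Sum>j\<in>UNIV. \<bar>(\<beta>s + t *\<^sub>R h) $ j\<bar>)
      \<le> (1 - t) * (\<Sum>j\<in>UNIV. \<bar>\<beta>s $ j\<bar>) + t * (\<Sum>j\<in>UNIV. \<bar>(\<beta>s + h) $ j\<bar>)"
    unfolding sum_distrib_left sum.distrib[symmetric] by (intro sum_mono)
  then have "2 * lam * (\<Sum>j\<in>UNIV. \<bar>(\<beta>s + t *\<^sub>R h) $ j\<bar>)
      \<le> 2 * lam * ((1 - t) * (\<Sum>j\<in>UNIV. \<bar>\<beta>s $ j\<bar>) + t * (\<Sum>j\<in>UNIV. \<bar>(\<beta>s + h) $ j\<bar>))"
    using lam_nonneg by (intro mult_left_mono) auto
  with L have "objective 0 abs (\<beta>s + t *\<^sub>R h)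
      \<le> (1 - t) * objective 0 abs \<beta>s + t * objective 0 abs (\<beta>s + h)"
    unfolding objective_def by (simp add: algebra_simps)
  then show ?thesis by (simp add: h_def)
qed

text \<open>
  Compactness of the sphere of radius \<open>r\<close> gives a positive excess there, and convexity along rays from the
  minimizer extends it to a linear lower bound outside. This treats a positive penalty and
  \<open>lam = 0\<close> with invertible \<open>A\<close> uniformly.
\<close>

lemma objective_growth:
  assumes "r > 0"
  obtains d where "d > 0"
    "\<And>\<beta>. r \<le> norm (\<beta> - \<beta>s) \<Longrightarrow> objective 0 abs \<beta>s + d * norm (\<beta> - \<beta>s) \<le> objective 0 abs \<beta>"
proof (cases "sphere \<beta>s r = {}")
  case True
  have False if "r \<le> norm (\<beta> - \<beta>s)" for \<beta>
  proof -
    have "dist \<beta>s (\<beta>s + (r / norm (\<beta> - \<beta>s)) *\<^sub>R (\<beta> - \<beta>s)) = r"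
      using that assms by (auto simp: dist_norm)
    then show False using True by (auto simp: sphere_def)
  qed
  then show ?thesis using that[of 1] by auto
next
  case False
  have "continuous_on UNIV (objective 0 abs)"
    by (intro continuous_on_objective continuous_intros)
  then have "continuous_on (sphere \<beta>s r) (objective 0 abs)" by (rule continuous_on_subset) auto
  from continuous_attains_inf[OF compact_sphere False this]
  obtain u where u: "u \<in> sphere \<beta>s r" "\<And>z. z \<in> sphere \<beta>s r \<Longrightarrow> objective 0 abs u \<le> objective 0 abs z"
    by blast
  define d where "d = (objective 0 abs u - objective 0 abs \<beta>s) / r"
  have "u \<noteq> \<beta>s" using u(1) assms by auto
  then have "d > 0" using unique assms by (simp add: d_def)
  moreover have "objective 0 abs \<beta>s + d * norm (\<beta> - \<beta>s) \<le> objective 0 abs \<beta>"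
    if n: "r \<le> norm (\<beta> - \<beta>s)" for \<beta>
  proof -
    define t where "t = r / norm (\<beta> - \<beta>s)"
    have np: "norm (\<beta> - \<beta>s) > 0" using n assms by linarith
    have t: "0 < t" "t \<le> 1" using n np assms by (auto simp: t_def)
    have "\<beta>s + t *\<^sub>R (\<beta> - \<beta>s) \<in> sphere \<beta>s r"
      using np assms by (simp add: t_def dist_norm)
    then have "objective 0 abs u \<le> objective 0 abs (\<beta>s + t *\<^sub>R (\<beta> - \<beta>s))" by (rule u(2))
    also have "\<dots> \<le> (1 - t) * objective 0 abs \<beta>s + t * objective 0 abs \<beta>"
      using t by (intro objective_segment_convex) auto
    moreover have "d * r = objective 0 abs u - objective 0 abs \<beta>s" using assms by (simp add: d_def)
    ultimately have "d * r \<le> t * (objective 0 abs \<beta> - objective 0 abs \<beta>s)"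
      by (simp add: algebra_simps)
    also have "\<dots> = r * (objective 0 abs \<beta> - objective 0 abs \<beta>s) / norm (\<beta> - \<beta>s)" by (simp add: t_def)
    finally have "r * (d * norm (\<beta> - \<beta>s)) \<le> r * (objective 0 abs \<beta> - objective 0 abs \<beta>s)"
      using np by (simp add: field_simps)
    then show ?thesis using assms by simp
  qed
  ultimately show ?thesis by (rule that)
qed

lemma near_optimal_imp_near:
  assumes "r > 0"
  obtains \<eta> where "\<eta> > 0"
    "\<And>\<beta>. objective 0 abs \<beta> < objective 0 abs \<beta>s + \<eta> \<Longrightarrow> norm (\<beta> - \<beta>s) < r"
proof -
  obtain d where d: "d > 0"
    "\<And>\<beta>. r \<le> norm (\<beta> - \<beta>s) \<Longrightarrow> objective 0 abs \<beta>s + d * norm (\<beta> - \<beta>s) \<le> objective 0 abs \<beta>"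
    using assms by (rule objective_growth) blast
  show ?thesis
  proof
    show "d * r > 0" using d(1) assms by simp
    fix \<beta> assume *: "objective 0 abs \<beta> < objective 0 abs \<beta>s + d * r"
    show "norm (\<beta> - \<beta>s) < r"
    proof (rule ccontr)
      assume "\<not> ?thesis"
      then have n: "r \<le> norm (\<beta> - \<beta>s)" by simp
      then have "d * r \<le> d * norm (\<beta> - \<beta>s)" using d(1) by simp
      with d(2)[OF n] * show False by simp
    qed
  qed
qed

lemma tendsto_lasso:
  assumes "((\<lambda>i. objective 0 abs (x i)) \<longlongrightarrow> objective 0 abs \<beta>s) F"
  shows "(x \<longlongrightarrow> \<beta>s) F"
proof (rule tendstoI)
  fix r :: real assume "r > 0"
  then obtain \<eta> where "\<eta> > 0"
    "\<And>\<beta>. objective 0 abs \<beta> < objective 0 abs \<beta>s + \<eta> \<Longrightarrow> norm (\<beta> - \<beta>s) < r"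
    by (rule near_optimal_imp_near) blast
  moreover from this(1) have "\<forall>\<^sub>F i in F. objective 0 abs (x i) < objective 0 abs \<beta>s + \<eta>"
    by (intro order_tendstoD(2)[OF assms]) simp
  ultimately show "\<forall>\<^sub>F i in F. dist (x i) \<beta>s < r"
    by (auto simp: dist_norm elim: eventually_mono)
qed

text \<open>
  The growth of the lasso objective passes to every penalty that is within a constant of the absolute value, and
  to every contamination level below \<open>1\<close>, so minimization can be restricted to a ball.
\<close>

lemma ex_minimizer:
  assumes J: "\<And>t. 0 \<le> J t" "\<And>t. \<bar>t\<bar> - C \<le> J t" "continuous_on UNIV J"
    and eps: "0 \<le> \<epsilon>" "\<epsilon> < 1"
  obtains x where "\<And>z. objective \<epsilon> J x \<le> objective \<epsilon> J z"
proof -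
  obtain d where d: "d > 0"
    "\<And>\<beta>. 1 \<le> norm (\<beta> - \<beta>s) \<Longrightarrow> objective 0 abs \<beta>s + d * norm (\<beta> - \<beta>s) \<le> objective 0 abs \<beta>"
    by (rule objective_growth[of 1]) auto
  define P where "P = 2 * lam * (real CARD('p) * C)"
  define T where "T = objective \<epsilon> J \<beta>s"
  define R where "R = max 1 ((T / (1 - \<epsilon>) + P - objective 0 abs \<beta>s) / d)"
  have far: "T \<le> objective \<epsilon> J z" if "R \<le> norm (z - \<beta>s)" for z
  proof -
    have R1: "1 \<le> R" "(T / (1 - \<epsilon>) + P - objective 0 abs \<beta>s) / d \<le> R" unfolding R_def by auto
    then have "T / (1 - \<epsilon>) + P - objective 0 abs \<beta>s \<le> R * d" using d(1) by (simp add: pos_divide_le_eq)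
    also have "R * d \<le> norm (z - \<beta>s) * d" using that d(1) by (intro mult_right_mono) auto
    finally have "T / (1 - \<epsilon>) \<le> objective 0 abs z - P"
      using d(2)[of z] R1 that by (simp add: mult.commute)
    also have "\<dots> \<le> objective 0 J z"
      using objective_abs_le[OF J(2), of 0 z] by (simp add: P_def)
    finally have "T \<le> (1 - \<epsilon>) * objective 0 J z"
      using eps by (simp add: pos_divide_le_eq mult.commute)
    also have "\<dots> \<le> objective \<epsilon> J z" using eps J by (intro objective_ge) auto
    finally show ?thesis .
  qed
  have "continuous_on (cball \<beta>s R) (objective \<epsilon> J)"
    by (rule continuous_on_subset[OF continuous_on_objective[OF J(3)]]) auto
  moreover have "cball \<beta>s R \<noteq> {}" unfolding R_def by auto
  ultimately obtain x where x: "\<And>z. z \<in> cball \<beta>s R \<Longrightarrow> objective \<epsilon> J x \<le> objective \<epsilon> J z"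
    using continuous_attains_inf[OF compact_cball] by blast
  show ?thesis
  proof (rule that)
    fix z
    have "objective \<epsilon> J x \<le> T" unfolding T_def by (rule x) (simp add: R_def)
    then show "objective \<epsilon> J x \<le> objective \<epsilon> J z"
      using x[of z] far[of z] by (cases "z \<in> cball \<beta>s R") (auto simp: dist_norm norm_minus_commute)
  qed
qed

lemma active_score:
  assumes "\<beta>s $ j \<noteq> 0"
  shows "score 0 \<beta>s $ j = lam * sgn (\<beta>s $ j)"
  using stationary[OF lasso_optimal has_real_derivative_abs[OF assms]] .

text \<open>
  If the score at an inactive coordinate exceeded \<open>lam\<close>, a short step in its direction would lower the objective: the
  gain is linear in the step length and the quadratic cost is negligible.
\<close>

lemma inactive_score:
  assumes "\<beta>s $ j = 0"
  shows "\<bar>score 0 \<beta>s $ j\<bar> \<le> lam"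
proof (rule ccontr)
  define r where "r = score 0 \<beta>s $ j"
  assume "\<not> ?thesis"
  then have r: "\<bar>r\<bar> > lam" by (simp add: r_def)
  define q where "q = A $ j $ j"
  have "axis j 1 \<bullet> (A *v axis j 1) = q"
    by (simp add: q_def inner_axis' matrix_vector_mul_component inner_axis)
  then have q: "q \<ge> 0" using A_psd[of "axis j 1"] by simp
  \<comment> \<open>The \<open>+ 1\<close> guards against \<open>q = 0\<close>; any \<open>t\<close> with \<open>t q < 2 (\<bar>r\<bar> - lam)\<close> would do.\<close>
  define t where "t = (\<bar>r\<bar> - lam) / (q + 1)"
  have t: "t > 0" using r q by (simp add: t_def)
  have "t * q < t * (q + 1)" using t by (intro mult_strict_left_mono) auto
  also have "\<dots> = \<bar>r\<bar> - lam" using q by (simp add: t_def)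
  also have "\<dots> < 2 * (\<bar>r\<bar> - lam)" using r by simp
  finally have *: "t * q < 2 * (\<bar>r\<bar> - lam)" .
  have "objective 0 abs \<beta>s \<le> objective 0 abs (\<beta>s + (t * sgn r) *\<^sub>R axis j 1)" by (rule lasso_optimal)
  then have "0 \<le> - 2 * (t * sgn r) * r + (t * sgn r)\<^sup>2 * q + 2 * lam * \<bar>t * sgn r\<bar>"
    unfolding objective_along_axis by (simp add: assms r_def q_def)
  moreover have "sgn r * r = \<bar>r\<bar>" "(sgn r)\<^sup>2 = 1" "\<bar>sgn r\<bar> = 1"
    using r lam_nonneg by (auto simp: sgn_if)
  moreover from this have "(t * sgn r) * r = t * \<bar>r\<bar>" "(t * sgn r)\<^sup>2 = t\<^sup>2" "\<bar>t * sgn r\<bar> = t"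
    using t by (simp_all add: mult.assoc power_mult_distrib abs_mult)
  ultimately have "0 \<le> - 2 * (t * \<bar>r\<bar>) + t\<^sup>2 * q + 2 * lam * t" by (simp add: mult.assoc)
  then have "0 \<le> t * (t * q - 2 * (\<bar>r\<bar> - lam))"
    by (simp add: power2_eq_square algebra_simps)
  with t * show False by (simp add: zero_le_mult_iff)
qed

lemma active_margin:
  obtains m where "m > 0" "\<And>j. \<beta>s $ j \<noteq> 0 \<Longrightarrow> m \<le> \<bar>\<beta>s $ j\<bar>"
proof
  \<comment> \<open>The \<open>1\<close> keeps the set nonempty if no coordinate is active.\<close>
  let ?S = "insert 1 ((\<lambda>j. \<bar>\<beta>s $ j\<bar>) ` {j. \<beta>s $ j \<noteq> 0})"
  show "Min ?S > 0" by (subst Min_gr_iff) auto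
  fix j assume "\<beta>s $ j \<noteq> 0"
  then show "Min ?S \<le> \<bar>\<beta>s $ j\<bar>" by (intro Min_le) auto
qed

text \<open>
  For small \<open>t\<close> no active coordinate changes sign between \<open>\<beta>s\<close> and \<open>\<beta>s + t v\<close>. The penalty is linear there,
  and its slope cancels against the score, so the increase of the objective is exactly
  \<open>t\<^sup>2 (v \<bullet> A v)\<close>. Uniqueness makes it positive.
\<close>

lemma active_block_pd:
  assumes v: "v \<noteq> 0" and supp: "\<And>j. \<beta>s $ j = 0 \<Longrightarrow> v $ j = 0"
  shows "v \<bullet> (A *v v) > 0"
proof -
  obtain m where m: "m > 0" "\<And>j. \<beta>s $ j \<noteq> 0 \<Longrightarrow> m \<le> \<bar>\<beta>s $ j\<bar>" by (rule active_margin) blast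
  \<comment> \<open>So that \<open>\<bar>t * v $ j\<bar> \<le> m\<close>, which does not exceed any active coordinate of \<open>\<beta>s\<close>.\<close>
  define t where "t = m / norm v"
  have t: "t > 0" using m v by (simp add: t_def)
  have "\<bar>\<beta>s $ j + t * v $ j\<bar> = \<bar>\<beta>s $ j\<bar> + t * (sgn (\<beta>s $ j) * v $ j)" for j
  proof (cases "\<beta>s $ j = 0")
    case False
    have "\<bar>t * v $ j\<bar> \<le> t * norm v"
      using component_le_norm_cart[of v j] t by (simp add: abs_mult)
    then have "\<bar>t * v $ j\<bar> \<le> \<bar>\<beta>s $ j\<bar>" using m(2)[OF False] v by (simp add: t_def)
    then show ?thesis using False by (auto simp: sgn_if abs_if split: if_splits)
  qed (simp add: supp)
  then have "(\<Sum>j\<in>UNIV. \<bar>(\<beta>s + t *\<^sub>R v) $ j\<bar>)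
      = (\<Sum>j\<in>UNIV. \<bar>\<beta>s $ j\<bar>) + t * (\<Sum>j\<in>UNIV. sgn (\<beta>s $ j) * v $ j)"
    by (simp add: sum.distrib sum_distrib_left)
  moreover have "score 0 \<beta>s \<bullet> v = lam * (\<Sum>j\<in>UNIV. sgn (\<beta>s $ j) * v $ j)"
    unfolding inner_vec_def sum_distrib_left
  proof (intro sum.cong refl)
    fix j show "score 0 \<beta>s $ j \<bullet> v $ j = lam * (sgn (\<beta>s $ j) * v $ j)"
      by (cases "\<beta>s $ j = 0") (simp_all add: supp active_score)
  qed
  ultimately have "objective 0 abs (\<beta>s + t *\<^sub>R v) = objective 0 abs \<beta>s + t\<^sup>2 * (v \<bullet> (A *v v))"
    unfolding objective_def loss_add
    by (simp add: matrix_vector_mult_scaleR power2_eq_square algebra_simps)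
  moreover have "objective 0 abs \<beta>s < objective 0 abs (\<beta>s + t *\<^sub>R v)"
    using v t by (intro unique) auto
  ultimately show ?thesis using t by (simp add: zero_less_mult_iff)
qed

lemma active_block_coercive:
  obtains c where "c > 0" "\<And>v. (\<And>j. \<beta>s $ j = 0 \<Longrightarrow> v $ j = 0) \<Longrightarrow> c * (norm v)\<^sup>2 \<le> v \<bullet> (A *v v)"
proof -
  define V where "V = {v :: real ^ 'p. \<forall>j. \<beta>s $ j = 0 \<longrightarrow> v $ j = 0}"
  define U where "U = sphere 0 1 \<inter> V"
  have "V = (\<Inter>j\<in>{j. \<beta>s $ j = 0}. {v. v $ j = 0})" by (auto simp: V_def)
  moreover have "closed {v :: real ^ 'p. v $ j = 0}" for j
    by (intro closed_Collect_eq continuous_intros)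
  ultimately have "closed V" by auto
  then have U: "compact U" unfolding U_def by (intro compact_Int_closed) auto
  have "\<exists>c>0. \<forall>v\<in>U. c \<le> v \<bullet> (A *v v)"
  proof (cases "U = {}")
    case False
    have "continuous_on U (\<lambda>v. v \<bullet> (A *v v))"
      by (intro continuous_intros linear_continuous_on matrix_vector_mul_bounded_linear)
    from continuous_attains_inf[OF U False this] obtain u
      where u: "u \<in> U" "\<And>v. v \<in> U \<Longrightarrow> u \<bullet> (A *v u) \<le> v \<bullet> (A *v v)" by blast
    have "u \<bullet> (A *v u) > 0" using u(1) by (intro active_block_pd) (auto simp: U_def V_def)
    with u(2) show ?thesis by blast
  qed (auto intro!: exI[of _ 1])
  then obtain c where c: "c > 0" "\<And>v. v \<in> U \<Longrightarrow> c \<le> v \<bullet> (A *v v)" by blast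
  have "c * (norm v)\<^sup>2 \<le> v \<bullet> (A *v v)" if "\<And>j. \<beta>s $ j = 0 \<Longrightarrow> v $ j = 0" for v
  proof (cases "v = 0")
    case False
    define u where "u = (1 / norm v) *\<^sub>R v"
    have "u \<in> U" using False that by (auto simp: u_def U_def V_def)
    then have "c \<le> u \<bullet> (A *v u)" by (rule c(2))
    also have "\<dots> = (v \<bullet> (A *v v)) / (norm v)\<^sup>2"
      by (simp add: u_def matrix_vector_mult_scaleR power2_eq_square)
    finally show ?thesis using False by (simp add: field_simps)
  qed simp
  with c(1) show ?thesis using that by blast
qed

text \<open>
  Split \<open>v\<close> into its active part \<open>u\<close> and its inactive part \<open>z\<close>. The active block bounds \<open>u\<close>, and a large weight on the
  inactive coordinates absorbs the cross term \<open>2 (z \<bullet> A u)\<close> by completing a square. A small negative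
  weight on the active coordinates does no harm; it is admitted because \<open>J\<^sub>K\<close> is slightly concave there.
\<close>

lemma ridge_on_inactive_coercive:
  obtains c \<mu> B where "c > 0" "\<mu> > 0"
    "\<And>m v. (\<And>j. \<beta>s $ j = 0 \<Longrightarrow> B \<le> m j) \<Longrightarrow> (\<And>j. \<beta>s $ j \<noteq> 0 \<Longrightarrow> - \<mu> \<le> m j) \<Longrightarrow>
       c * (norm v)\<^sup>2 \<le> v \<bullet> (A *v v) + (\<Sum>j\<in>UNIV. m j * (v $ j)\<^sup>2)"
proof -
  obtain c where c: "c > 0"
    "\<And>v. (\<And>j. \<beta>s $ j = 0 \<Longrightarrow> v $ j = 0) \<Longrightarrow> c * (norm v)\<^sup>2 \<le> v \<bullet> (A *v v)"
    by (rule active_block_coercive) blast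
  obtain B where B: "B > 0" "\<And>v. norm (A *v v) \<le> B * norm v" by (rule matrix_vector_bound[of A]) blast
  \<comment> \<open>The first summand pays for the cross term, the second one leaves \<open>c / 4\<close> for the result.\<close>
  define M where "M = 2 * B\<^sup>2 / c + c / 4"
  show ?thesis
  proof (rule that[of "c / 4" "c / 4" M])
    show "c / 4 > 0" "c / 4 > 0" using c by auto
    fix m :: "'p \<Rightarrow> real" and v :: "real ^ 'p"
    assume m: "\<And>j. \<beta>s $ j = 0 \<Longrightarrow> M \<le> m j" "\<And>j. \<beta>s $ j \<noteq> 0 \<Longrightarrow> - (c / 4) \<le> m j"
    define u where "u = (\<chi> j. if \<beta>s $ j = 0 then 0 else v $ j)"
    define z where "z = (\<chi> j. if \<beta>s $ j = 0 then v $ j else 0)"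
    have vuz: "v = u + z" by (simp add: vec_eq_iff u_def z_def)
    have nv: "(norm v)\<^sup>2 = (norm u)\<^sup>2 + (norm z)\<^sup>2"
      unfolding norm_sq_eq_sum sum.distrib[symmetric] by (intro sum.cong) (auto simp: u_def z_def)
    have "M * (norm z)\<^sup>2 - c / 4 * (norm u)\<^sup>2 \<le> (\<Sum>j\<in>UNIV. m j * (v $ j)\<^sup>2)"
      unfolding norm_sq_eq_sum sum_distrib_left sum_subtractf[symmetric]
    proof (intro sum_mono)
      fix j
      show "M * (z $ j)\<^sup>2 - c / 4 * (u $ j)\<^sup>2 \<le> m j * (v $ j)\<^sup>2"
        using mult_right_mono[OF m(1), of j "(v $ j)\<^sup>2"] mult_right_mono[OF m(2), of j "(v $ j)\<^sup>2"]
        by (cases "\<beta>s $ j = 0") (auto simp: u_def z_def)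
    qed
    moreover have "c / 2 * (norm u)\<^sup>2 - 2 * B\<^sup>2 / c * (norm z)\<^sup>2 \<le> v \<bullet> (A *v v)"
    proof -
      have 1: "v \<bullet> (A *v v) = u \<bullet> (A *v u) + 2 * (z \<bullet> (A *v u)) + z \<bullet> (A *v z)"
        unfolding vuz using A_sym[of u z]
        by (simp add: matrix_vector_right_distrib inner_simps)
      have "c * (norm u)\<^sup>2 \<le> u \<bullet> (A *v u)" by (rule c(2)) (simp add: u_def)
      moreover have "\<bar>z \<bullet> (A *v u)\<bar> \<le> norm z * (B * norm u)"
        using Cauchy_Schwarz_ineq2[of z "A *v u"] mult_left_mono[OF B(2)[of u], of "norm z"] by simp
      moreover have "2 * (norm z * (B * norm u)) \<le> c / 2 * (norm u)\<^sup>2 + 2 * B\<^sup>2 / c * (norm z)\<^sup>2"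
      proof -
        have "0 \<le> c / 2 * (norm u - 2 * B / c * norm z)\<^sup>2" using c(1) by simp
        also have "\<dots> = c / 2 * (norm u)\<^sup>2 + 2 * B\<^sup>2 / c * (norm z)\<^sup>2 - 2 * (norm z * (B * norm u))"
          using c(1) by (simp add: power2_eq_square field_simps)
        finally show ?thesis by simp
      qed
      moreover have "0 \<le> z \<bullet> (A *v z)" by (rule A_psd)
      ultimately show ?thesis unfolding 1 by (simp add: abs_le_iff)
    qed
    ultimately show "c / 4 * (norm v)\<^sup>2 \<le> v \<bullet> (A *v v) + (\<Sum>j\<in>UNIV. m j * (v $ j)\<^sup>2)"
      unfolding nv M_def by (simp add: algebra_simps)
  qed
qed

end

section \<open>Localization of smoothed minimizers\<close>

lemma add_diag_mult_component:
  fixes A :: "real ^ 'n ^ 'n"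
  shows "((\<chi> i j. A $ i $ j + (if i = j then d i else 0)) *v v) $ i = (A *v v) $ i + d i * v $ i"
proof -
  have "(\<Sum>j\<in>UNIV. (A $ i $ j + (if i = j then d i else 0)) * v $ j)
      = (\<Sum>j\<in>UNIV. A $ i $ j * v $ j + (if i = j then d i * v $ j else 0))"
    by (intro sum.cong) (auto simp: algebra_simps)
  then show ?thesis by (simp add: matrix_vector_mult_def sum.distrib)
qed

lemma arg_min_is_minimizer:
  fixes f :: "'c \<Rightarrow> real"
  assumes "\<And>z. f x \<le> f z"
  shows "f (arg_min f (\<lambda>_. True)) \<le> f z"
proof -
  have "is_arg_min f (\<lambda>_. True) (arg_min f (\<lambda>_. True))"
    unfolding arg_min_def
    by (rule someI[of "is_arg_min f (\<lambda>_. True)" x]) (use assms in \<open>simp add: is_arg_min_def not_less\<close>)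
  then show ?thesis by (auto simp: is_arg_min_def not_less)
qed

lemma continuous_on_tanh_penalty: "continuous_on UNIV (tanh_penalty K)"
  by (intro continuous_at_imp_continuous_on ballI DERIV_isCont[OF tanh_penalty_deriv])

context unique_lasso begin

lemma penalized_if_inactive: "\<beta>s $ j = 0 \<Longrightarrow> 0 < lam"
  using lam_nonneg active_if_unpenalized[of j] by (cases "lam = 0") auto

definition tanh_minimizer :: "real \<Rightarrow> real \<Rightarrow> real ^ 'p" where
  "tanh_minimizer K \<epsilon> = arg_min (objective \<epsilon> (tanh_penalty K)) (\<lambda>_. True)"

text \<open>
  The box on which the smoothed objective is strongly convex: inactive coordinates within the convex core of \<open>J\<^sub>K\<close>, and
  active ones well away from \<open>0\<close>. Stated as a product of intervals so that it is closed under
  coordinatewise intermediate values.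
\<close>

definition localized :: "real \<Rightarrow> real ^ 'p \<Rightarrow> bool" where
  "localized K x \<longleftrightarrow> (\<forall>j. if \<beta>s $ j = 0 then \<bar>x $ j\<bar> \<le> 1 / K else \<bar>x $ j - \<beta>s $ j\<bar> \<le> \<bar>\<beta>s $ j\<bar> / 2)"

lemma localized_inactive: "localized K x \<Longrightarrow> \<beta>s $ j = 0 \<Longrightarrow> \<bar>x $ j\<bar> \<le> 1 / K"
  by (auto simp: localized_def split: if_splits)

lemma localized_active:
  assumes "localized K x" "\<beta>s $ j \<noteq> 0"
  shows "\<bar>\<beta>s $ j\<bar> / 2 \<le> \<bar>x $ j\<bar>" "x $ j \<noteq> 0"
proof -
  have "\<bar>x $ j - \<beta>s $ j\<bar> \<le> \<bar>\<beta>s $ j\<bar> / 2"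
    using assms by (auto simp: localized_def split: if_splits)
  then show "\<bar>\<beta>s $ j\<bar> / 2 \<le> \<bar>x $ j\<bar>" by (simp add: abs_if split: if_splits)
  then show "x $ j \<noteq> 0" using assms(2) by auto
qed

lemma tanh_minimizer:
  assumes "K > 0" "0 \<le> \<epsilon>" "\<epsilon> < 1"
  shows "objective \<epsilon> (tanh_penalty K) (tanh_minimizer K \<epsilon>) \<le> objective \<epsilon> (tanh_penalty K) z"
proof -
  obtain x where "\<And>z. objective \<epsilon> (tanh_penalty K) x \<le> objective \<epsilon> (tanh_penalty K) z"
    using ex_minimizer[OF tanh_penalty_nonneg tanh_penalty_ge continuous_on_tanh_penalty] assms by metis
  then show ?thesis unfolding tanh_minimizer_def by (rule arg_min_is_minimizer)
qed

text \<open>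
  Expanding around \<open>\<beta>s\<close> separates the coordinates up to the quadratic terms. Those will be of order
  \<open>1/K\<^sup>2\<close> at the comparison point, while the separable part decides at order \<open>1/K\<close>.
\<close>

lemma objective_diff:
  "objective 0 J x - objective 0 J z =
     (x - \<beta>s) \<bullet> (A *v (x - \<beta>s)) - (z - \<beta>s) \<bullet> (A *v (z - \<beta>s))
     + 2 * (\<Sum>j\<in>UNIV. lam * (J (x $ j) - J (z $ j)) - score 0 \<beta>s $ j * (x $ j - z $ j))"
proof -
  have 1: "loss 0 x = loss 0 \<beta>s - 2 * (score 0 \<beta>s \<bullet> (x - \<beta>s)) + (x - \<beta>s) \<bullet> (A *v (x - \<beta>s))" for x
    using loss_add[of 0 \<beta>s "x - \<beta>s"] by simp
  have 2: "score 0 \<beta>s \<bullet> (x - \<beta>s) - score 0 \<beta>s \<bullet> (z - \<beta>s) = (\<Sum>j\<in>UNIV. score 0 \<beta>s $ j * (x $ j - z $ j))"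
    unfolding inner_diff_right[symmetric] by (simp add: inner_vec_def)
  show ?thesis
    unfolding objective_def 1[of x] 1[of z] sum_subtractf 2[symmetric]
    by (simp add: sum_distrib_left[symmetric] sum_subtractf algebra_simps)
qed

lemma near_optimal_close:
  assumes "r > 0"
  shows "\<forall>\<^sub>F K in at_top. \<forall>x. objective 0 (tanh_penalty K) x \<le> objective 0 (tanh_penalty K) \<beta>s + 1 / K\<^sup>2
            \<longrightarrow> norm (x - \<beta>s) < r"
proof -
  obtain \<eta> where \<eta>: "\<eta> > 0"
    "\<And>\<beta>. objective 0 abs \<beta> < objective 0 abs \<beta>s + \<eta> \<Longrightarrow> norm (\<beta> - \<beta>s) < r"
    using near_optimal_imp_near[OF assms] by blast
  define C where "C = 1 + 2 * lam * real CARD('p)"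
  show ?thesis
    using eventually_gt_at_top[of 1] eventually_gt_at_top[of "C / \<eta>"]
  proof eventually_elim
    case (elim K)
    show ?case
    proof (intro allI impI)
      fix x assume x: "objective 0 (tanh_penalty K) x \<le> objective 0 (tanh_penalty K) \<beta>s + 1 / K\<^sup>2"
      have "objective 0 abs x \<le> objective 0 (tanh_penalty K) x + 2 * lam * (real CARD('p) * (1 / K))"
        using elim by (intro objective_abs_le tanh_penalty_ge) auto
      moreover have "objective 0 (tanh_penalty K) \<beta>s \<le> objective 0 abs \<beta>s"
        by (intro objective_mono tanh_penalty_le_abs)
      moreover have "1 / K\<^sup>2 \<le> 1 / K" using elim by (simp add: power2_eq_square field_simps)
      ultimately have "objective 0 abs x \<le> objective 0 abs \<beta>s + C / K"
        using x by (simp add: C_def add_divide_distrib)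
      also have "\<dots> < objective 0 abs \<beta>s + \<eta>" using elim \<eta>(1) by (simp add: field_simps)
      finally show "norm (x - \<beta>s) < r" by (rule \<eta>(2))
    qed
  qed
qed

text \<open>
  By \<open>near_optimal_close\<close> a nearly optimal \<open>x\<close> has its active coordinates near those of \<open>\<beta>s\<close>. Suppose some
  inactive coordinate of \<open>x\<close> is larger than \<open>1/K\<close>. Compare \<open>x\<close> with the point \<open>z\<close> that has the active coordinates of
  \<open>\<beta>s\<close> and whose inactive coordinates are those of \<open>x\<close>, except that the large ones are replaced by the better
  values of \<open>mult_tanh_gap\<close>. The replacement gains at least \<open>lam/(25 K)\<close>; everything else, including
  the tolerance \<open>1/K\<^sup>2\<close>, costs \<open>O(1/K\<^sup>2)\<close>. All coordinates are changed simultaneously, because changing one of them at a time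
  would leave a quadratic term that is not under control.
\<close>

lemma near_optimal_localized:
  "\<forall>\<^sub>F K in at_top. \<forall>x. (\<forall>z. objective 0 (tanh_penalty K) x \<le> objective 0 (tanh_penalty K) z + 1 / K\<^sup>2)
      \<longrightarrow> localized K x"
proof -
  obtain m where m: "m > 0" "\<And>j. \<beta>s $ j \<noteq> 0 \<Longrightarrow> m \<le> \<bar>\<beta>s $ j\<bar>" by (rule active_margin) blast
  obtain B where B: "B > 0" "\<And>v. norm (A *v v) \<le> B * norm v" by (rule matrix_vector_bound[of A]) blast
  define p where "p = real CARD('p)"
  \<comment> \<open>Tolerance, quadratic term of the comparison point and loss at active coordinates, each times \<open>K\<^sup>2\<close>.\<close>
  define C where "C = 1 + B * p\<^sup>2 + 2 * (p * (4 * lam / m))"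
  have "m / 2 > 0" using m by simp
  from near_optimal_close[OF this]
  show ?thesis
    using eventually_gt_at_top[of 1] eventually_gt_at_top[of "C * 25 / lam"]
  proof eventually_elim
    case (elim K)
    let ?J = "tanh_penalty K"
    have K: "K > 1" by fact
    show ?case
    proof (intro allI impI)
      fix x assume opt: "\<forall>z. objective 0 ?J x \<le> objective 0 ?J z + 1 / K\<^sup>2"
      have close: "norm (x - \<beta>s) < m / 2" using elim(1) opt by blast
      have active: "\<bar>x $ j - \<beta>s $ j\<bar> \<le> \<bar>\<beta>s $ j\<bar> / 2" "m / 2 \<le> \<bar>x $ j\<bar>" "sgn (x $ j) = sgn (\<beta>s $ j)"
        if "\<beta>s $ j \<noteq> 0" for j
      proof -
        have "\<bar>x $ j - \<beta>s $ j\<bar> < m / 2"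
          using component_le_norm_cart[of "x - \<beta>s" j] close by simp
        note near = this m(2)[OF that]
        show "\<bar>x $ j - \<beta>s $ j\<bar> \<le> \<bar>\<beta>s $ j\<bar> / 2" "m / 2 \<le> \<bar>x $ j\<bar>"
          using near by linarith+
        show "sgn (x $ j) = sgn (\<beta>s $ j)"
        proof (cases "\<beta>s $ j > 0")
          case True
          then have "x $ j > 0" using near by linarith
          with True show ?thesis by simp
        next
          case False
          then have neg: "\<beta>s $ j < 0" using that by simp
          then have "x $ j < 0" using near by linarith
          with neg show ?thesis by simp
        qed
      qed
      have inactive: "\<bar>x $ i\<bar> \<le> 1 / K" if i: "\<beta>s $ i = 0" for i
      proof (rule ccontr)
        assume "\<not> ?thesis"
        then have xi: "\<bar>K * x $ i\<bar> > 1" using K by (simp add: abs_mult field_simps)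
        have lam: "lam > 0" using i by (rule penalized_if_inactive)
        let ?r = "\<lambda>j. score 0 \<beta>s $ j"
        have "\<exists>s'. \<beta>s $ j = 0 \<longrightarrow> \<bar>s'\<bar> \<le> 1 \<and> (\<forall>s. \<bar>s\<bar> \<ge> 1 \<longrightarrow>
           lam * (s' * tanh s') - ?r j * s' + lam / 50 \<le> lam * (s * tanh s) - ?r j * s)" for j
        proof (cases "\<beta>s $ j = 0")
          case True
          then show ?thesis using mult_tanh_gap[OF inactive_score[OF True]] by blast
        qed simp
        then obtain s' where s': "\<And>j. \<beta>s $ j = 0 \<Longrightarrow> \<bar>s' j\<bar> \<le> 1"
          "\<And>j s. \<beta>s $ j = 0 \<Longrightarrow> \<bar>s\<bar> \<ge> 1 \<Longrightarrow>
             lam * (s' j * tanh (s' j)) - ?r j * s' j + lam / 50 \<le> lam * (s * tanh s) - ?r j * s"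
          by metis
        \<comment> \<open>The comparison point; it lies within \<open>1/K\<close> of \<open>\<beta>s\<close> in every coordinate.\<close>
        define z where "z = (\<chi> j. if \<beta>s $ j \<noteq> 0 then \<beta>s $ j
            else if \<bar>K * x $ j\<bar> \<le> 1 then x $ j else s' j / K)"
        define T where "T j = lam * (?J (x $ j) - ?J (z $ j)) - ?r j * (x $ j - z $ j)" for j
        \<comment> \<open>A bound for the loss at one active coordinate, where \<open>\<bar>x $ j\<bar> \<ge> m / 2\<close>.\<close>
        define q where "q = 4 * lam / m / K\<^sup>2"
        have q: "q \<ge> 0" using lam m by (simp add: q_def)
        have gap: "lam / (50 * K) \<le> T j" if j: "\<beta>s $ j = 0" "\<bar>K * x $ j\<bar> > 1" for j
        proof -
          have zj: "z $ j = s' j / K" using j by (simp add: z_def)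
          have "lam * (s' j * tanh (s' j)) - ?r j * s' j + lam / 50
             \<le> lam * (K * x $ j * tanh (K * x $ j)) - ?r j * (K * x $ j)"
            using s'(2)[OF j(1), of "K * x $ j"] j(2) by simp
          then have "lam / 50 \<le> K * T j"
            using K by (simp add: T_def zj tanh_penalty_def algebra_simps)
          then show ?thesis using K by (simp add: field_simps)
        qed
        have T_ge: "- q \<le> T j" for j
        proof (cases "\<beta>s $ j = 0")
          case True
          show ?thesis
          proof (cases "\<bar>K * x $ j\<bar> \<le> 1")
            case True
            then have "T j = 0" using \<open>\<beta>s $ j = 0\<close> by (simp add: T_def z_def)
            then show ?thesis using q by simp
          next
            case False
            then have "lam / (50 * K) \<le> T j" using gap[of j] True by simp
            moreover have "lam / (50 * K) \<ge> 0" using lam K by simp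
            ultimately show ?thesis using q by linarith
          qed
        next
          case False
          have xj: "x $ j \<noteq> 0" using active(2)[OF False] m(1) by auto
          have zj: "z $ j = \<beta>s $ j" using False by (simp add: z_def)
          have "?r j * x $ j = lam * \<bar>x $ j\<bar>" "?r j * \<beta>s $ j = lam * \<bar>\<beta>s $ j\<bar>"
            using active_score[OF False] active(3)[OF False] by (simp_all add: abs_sgn mult_ac)
          then have "T j = lam * (\<bar>\<beta>s $ j\<bar> - ?J (\<beta>s $ j)) - lam * (\<bar>x $ j\<bar> - ?J (x $ j))"
            by (simp add: T_def zj algebra_simps)
          moreover have "0 \<le> lam * (\<bar>\<beta>s $ j\<bar> - ?J (\<beta>s $ j))"
            using lam tanh_penalty_le_abs[of K "\<beta>s $ j"] by simp
          moreover have "lam * (\<bar>x $ j\<bar> - ?J (x $ j)) \<le> lam * (2 / (K\<^sup>2 * \<bar>x $ j\<bar>))"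
            using lam tanh_penalty_ge_away[of K "x $ j"] K xj by (intro mult_left_mono) auto
          moreover have "lam * (2 / (K\<^sup>2 * \<bar>x $ j\<bar>)) \<le> lam * (2 / (K\<^sup>2 * (m / 2)))"
            using lam K m active(2)[OF False] by (intro mult_left_mono divide_left_mono mult_pos_pos) auto
          moreover have "lam * (2 / (K\<^sup>2 * (m / 2))) = q" using m K by (simp add: q_def field_simps)
          ultimately show ?thesis by linarith
        qed
        have "lam / (50 * K) - p * q \<le> (\<Sum>j\<in>UNIV. T j)"
        proof -
          have "(\<Sum>j\<in>UNIV. (if j = i then lam / (50 * K) else 0) - q) \<le> (\<Sum>j\<in>UNIV. T j)"
          proof (intro sum_mono)
            fix j show "(if j = i then lam / (50 * K) else 0) - q \<le> T j"
              using gap[of i] i xi q T_ge[of j] by auto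
          qed
          then show ?thesis by (simp add: sum_subtractf p_def)
        qed
        moreover have "(z - \<beta>s) \<bullet> (A *v (z - \<beta>s)) \<le> B * p\<^sup>2 / K\<^sup>2"
        proof -
          have "norm (z - \<beta>s) \<le> (\<Sum>j\<in>UNIV. \<bar>(z - \<beta>s) $ j\<bar>)" by (rule norm_le_l1_cart)
          also have "\<dots> \<le> (\<Sum>j\<in>(UNIV :: 'p set). 1 / K)"
          proof (intro sum_mono)
            fix j
            show "\<bar>(z - \<beta>s) $ j\<bar> \<le> 1 / K"
              using K s'(1)[of j] by (auto simp: z_def abs_mult field_simps)
          qed
          finally have n: "norm (z - \<beta>s) \<le> p / K" by (simp add: p_def)
          have "(z - \<beta>s) \<bullet> (A *v (z - \<beta>s)) \<le> norm (z - \<beta>s) * norm (A *v (z - \<beta>s))"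
            by (rule norm_cauchy_schwarz)
          also have "\<dots> \<le> norm (z - \<beta>s) * (B * norm (z - \<beta>s))" using B(2) by (intro mult_left_mono) auto
          also have "\<dots> = B * (norm (z - \<beta>s))\<^sup>2" by (simp add: power2_eq_square)
          also have "\<dots> \<le> B * (p / K)\<^sup>2" using n B(1) by (intro mult_left_mono power_mono) auto
          finally show ?thesis by (simp add: power_divide)
        qed
        moreover have "0 \<le> (x - \<beta>s) \<bullet> (A *v (x - \<beta>s))" by (rule A_psd)
        moreover have "objective 0 ?J x - objective 0 ?J z \<le> 1 / K\<^sup>2"
          using opt[rule_format, of z] by simp
        ultimately have "2 * (lam / (50 * K)) \<le> 1 / K\<^sup>2 + B * p\<^sup>2 / K\<^sup>2 + 2 * (p * q)"
          unfolding objective_diff T_def[symmetric] by simp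
        also have "\<dots> = C / K\<^sup>2"
          by (simp add: C_def q_def add_divide_distrib)
        finally have "lam * K \<le> C * 25"
          using K by (simp add: power2_eq_square field_simps)
        moreover have "C * 25 < K * lam" using elim(3) lam by (simp add: pos_divide_less_eq)
        ultimately show False by (simp add: mult.commute)
      qed
      show "localized K x" unfolding localized_def using active(1) inactive by auto
    qed
  qed
qed

lemma curvature_at_inactive:
  assumes "K > 0" "localized K x" "\<beta>s $ j = 0"
  shows "central_curvature * K \<le> tanh_penalty_deriv2 K (x $ j)"
proof (rule tanh_penalty_deriv2_ge_near_0)
  show "\<bar>K * x $ j\<bar> \<le> 1"
    using localized_inactive[OF assms(2,3)] assms(1) by (simp add: abs_mult field_simps)
qed (rule assms)

lemma curvature_at_active:
  assumes "K > 0" "localized K x" "\<beta>s $ j \<noteq> 0" and m: "0 < m" "m \<le> \<bar>\<beta>s $ j\<bar>"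
  shows "\<bar>tanh_penalty_deriv2 K (x $ j)\<bar> \<le> 27 / (m / 2)\<^sup>2 / K"
proof -
  have "m / 2 \<le> \<bar>x $ j\<bar>" using localized_active(1)[OF assms(2,3)] m by simp
  then have "(m / 2)\<^sup>2 \<le> \<bar>x $ j\<bar>\<^sup>2" using m by (intro power_mono) auto
  then have "(m / 2)\<^sup>2 \<le> (x $ j)\<^sup>2" by simp
  then have "27 / (K * (x $ j)\<^sup>2) \<le> 27 / (K * (m / 2)\<^sup>2)"
    using assms m localized_active(2)[OF assms(2,3)]
    by (intro divide_left_mono mult_left_mono mult_pos_pos) auto
  moreover have "27 / (K * (m / 2)\<^sup>2) = 27 / (m / 2)\<^sup>2 / K" by (simp add: mult.commute)
  ultimately show ?thesis
    using tanh_penalty_deriv2_away[OF assms(1) localized_active(2)[OF assms(2,3)]] by linarith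
qed

text \<open>
  Inside the box \<open>J\<^sub>K''\<close> is at least of order \<open>K\<close> at inactive coordinates and \<open>O(1/K)\<close> at active ones, so that the
  Hessian has the form treated in \<open>ridge_on_inactive_coercive\<close>.
\<close>

lemma localized_curvature:
  obtains c where "c > 0"
    "\<forall>\<^sub>F K in at_top. \<forall>x. localized K x \<longrightarrow> (\<forall>v.
       c * (norm v)\<^sup>2 \<le> v \<bullet> (A *v v) + (\<Sum>j\<in>UNIV. lam * tanh_penalty_deriv2 K (x $ j) * (v $ j)\<^sup>2))"
proof -
  obtain c \<mu> B where c: "c > 0" "\<mu> > 0"
    "\<And>m v. (\<And>j. \<beta>s $ j = 0 \<Longrightarrow> B \<le> m j) \<Longrightarrow> (\<And>j. \<beta>s $ j \<noteq> 0 \<Longrightarrow> - \<mu> \<le> m j) \<Longrightarrow>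
       c * (norm v)\<^sup>2 \<le> v \<bullet> (A *v v) + (\<Sum>j\<in>UNIV. m j * (v $ j)\<^sup>2)"
    by (rule ridge_on_inactive_coercive) blast
  obtain m where m: "m > 0" "\<And>j. \<beta>s $ j \<noteq> 0 \<Longrightarrow> m \<le> \<bar>\<beta>s $ j\<bar>" by (rule active_margin) blast
  define D where "D = lam * (27 / (m / 2)\<^sup>2)"
  have "\<forall>\<^sub>F K in at_top. \<forall>x. localized K x \<longrightarrow> (\<forall>v.
       c * (norm v)\<^sup>2 \<le> v \<bullet> (A *v v) + (\<Sum>j\<in>UNIV. lam * tanh_penalty_deriv2 K (x $ j) * (v $ j)\<^sup>2))"
    using eventually_gt_at_top[of 0] eventually_gt_at_top[of "B / (lam * central_curvature)"]
      eventually_gt_at_top[of "D / \<mu>"]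
  proof eventually_elim
    case (elim K)
    show ?case
    proof (intro allI impI c(3))
      fix x j assume loc: "localized K x"
      {
        assume j: "\<beta>s $ j = 0"
        have lam: "lam > 0" using j by (rule penalized_if_inactive)
        have "lam * (central_curvature * K) \<le> lam * tanh_penalty_deriv2 K (x $ j)"
          using curvature_at_inactive[OF elim(1) loc j] lam by (intro mult_left_mono) auto
        moreover have "B \<le> lam * (central_curvature * K)"
          using elim lam central_curvature_pos by (simp add: field_simps)
        ultimately show "B \<le> lam * tanh_penalty_deriv2 K (x $ j)" by linarith
      }
      {
        assume j: "\<beta>s $ j \<noteq> 0"
        have "lam * - tanh_penalty_deriv2 K (x $ j) \<le> lam * (27 / (m / 2)\<^sup>2 / K)"
          using curvature_at_active[OF elim(1) loc j m(1) m(2)[OF j]] lam_nonneg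
          by (intro mult_left_mono) auto
        also have "\<dots> = D / K" by (simp add: D_def)
        also have "\<dots> \<le> \<mu>" using elim c(2) by (simp add: field_simps)
        finally show "- \<mu> \<le> lam * tanh_penalty_deriv2 K (x $ j)" by simp
      }
    qed
  qed
  with c(1) show ?thesis by (rule that)
qed

text \<open>
  The mean value theorem in each coordinate. Collecting the intermediate values in a point of the same box lets the
  curvature bound apply to differences of the stationarity equations.
\<close>

lemma localized_secant:
  assumes "localized K x" "localized K x'"
  obtains \<xi> where "localized K \<xi>"
    "\<And>j. tanh_penalty_deriv K (x $ j) - tanh_penalty_deriv K (x' $ j)
        = tanh_penalty_deriv2 K (\<xi> $ j) * (x $ j - x' $ j)"
proof -
  have mvt: "\<exists>\<xi>. min s t \<le> \<xi> \<and> \<xi> \<le> max s t \<and>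
      tanh_penalty_deriv K s - tanh_penalty_deriv K t = tanh_penalty_deriv2 K \<xi> * (s - t)" for s t
  proof (cases s t rule: linorder_cases)
    case less
    then obtain \<xi> where "s < \<xi>" "\<xi> < t"
      "tanh_penalty_deriv K t - tanh_penalty_deriv K s = (t - s) * tanh_penalty_deriv2 K \<xi>"
      using MVT2[OF less, of "tanh_penalty_deriv K" "tanh_penalty_deriv2 K"] tanh_penalty_deriv2 by blast
    then show ?thesis by (intro exI[of _ \<xi>]) (auto simp: algebra_simps)
  next
    case equal
    then show ?thesis by auto
  next
    case greater
    then obtain \<xi> where "t < \<xi>" "\<xi> < s"
      "tanh_penalty_deriv K s - tanh_penalty_deriv K t = (s - t) * tanh_penalty_deriv2 K \<xi>"
      using MVT2[OF greater, of "tanh_penalty_deriv K" "tanh_penalty_deriv2 K"] tanh_penalty_deriv2 by blast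
    then show ?thesis by (intro exI[of _ \<xi>]) (auto simp: algebra_simps)
  qed
  define \<xi> where "\<xi> = (\<chi> j. SOME \<xi>. min (x $ j) (x' $ j) \<le> \<xi> \<and> \<xi> \<le> max (x $ j) (x' $ j) \<and>
      tanh_penalty_deriv K (x $ j) - tanh_penalty_deriv K (x' $ j) = tanh_penalty_deriv2 K \<xi> * (x $ j - x' $ j))"
  have \<xi>: "min (x $ j) (x' $ j) \<le> \<xi> $ j \<and> \<xi> $ j \<le> max (x $ j) (x' $ j) \<and>
      tanh_penalty_deriv K (x $ j) - tanh_penalty_deriv K (x' $ j) = tanh_penalty_deriv2 K (\<xi> $ j) * (x $ j - x' $ j)" for j
    unfolding \<xi>_def vec_lambda_beta by (rule someI_ex[OF mvt])
  have "localized K \<xi>"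
    unfolding localized_def
  proof (intro allI)
    fix j
    have between: "\<bar>\<xi> $ j - w\<bar> \<le> d" if "\<bar>x $ j - w\<bar> \<le> d" "\<bar>x' $ j - w\<bar> \<le> d" for w d
      using that \<xi>[of j] by linarith
    show "if \<beta>s $ j = 0 then \<bar>\<xi> $ j\<bar> \<le> 1 / K else \<bar>\<xi> $ j - \<beta>s $ j\<bar> \<le> \<bar>\<beta>s $ j\<bar> / 2"
      using assms[unfolded localized_def, THEN spec, of j] between[of 0] between[of "\<beta>s $ j"]
      by (simp split: if_splits del: le_divide_eq_numeral1)
  qed
  with \<xi> show ?thesis using that by blast
qed

end

section \<open>Difference quotients in the contamination level\<close>

context unique_lasso begin

definition lasso_minimizer :: "real \<Rightarrow> real ^ 'p" where
  "lasso_minimizer \<epsilon> = arg_min (objective \<epsilon> abs) (\<lambda>_. True)"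

lemma lasso_minimizer:
  assumes "0 \<le> \<epsilon>" "\<epsilon> < 1"
  shows "objective \<epsilon> abs (lasso_minimizer \<epsilon>) \<le> objective \<epsilon> abs z"
proof -
  obtain x where "\<And>z. objective \<epsilon> abs x \<le> objective \<epsilon> abs z"
    by (rule ex_minimizer[of abs 0 \<epsilon>]) (use assms in \<open>auto intro!: continuous_intros\<close>)
  then show ?thesis unfolding lasso_minimizer_def by (rule arg_min_is_minimizer)
qed

lemma lasso_minimizer_0: "lasso_minimizer 0 = \<beta>s"
  using lasso_minimizer[of 0 \<beta>s] unique[of "lasso_minimizer 0"] by fastforce

lemma tanh_minimizer_score:
  assumes "K > 0" "0 \<le> \<epsilon>" "\<epsilon> < 1"
  shows "score \<epsilon> (tanh_minimizer K \<epsilon>) $ j = lam * tanh_penalty_deriv K (tanh_minimizer K \<epsilon> $ j)"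
  using stationary[OF tanh_minimizer[OF assms] tanh_penalty_deriv] .

lemma tanh_minimizer_tendsto_lasso: "((\<lambda>K. tanh_minimizer K 0) \<longlongrightarrow> \<beta>s) at_top"
proof (rule tendstoI)
  fix r :: real assume "r > 0"
  from near_optimal_close[OF this] eventually_gt_at_top[of 0]
  show "\<forall>\<^sub>F K in at_top. dist (tanh_minimizer K 0) \<beta>s < r"
  proof eventually_elim
    case (elim K)
    have "objective 0 (tanh_penalty K) (tanh_minimizer K 0) \<le> objective 0 (tanh_penalty K) \<beta>s"
      using elim by (intro tanh_minimizer) auto
    also have "\<dots> \<le> objective 0 (tanh_penalty K) \<beta>s + 1 / K\<^sup>2" by simp
    finally show ?case using elim(1) by (simp add: dist_norm)
  qed
qed

text \<open>
  This is the implicit function theorem at a strongly convex point, carried out by hand so that it speaks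
  about the global minimizers selected by \<open>arg_min\<close>. For small \<open>\<epsilon>\<close> they are localized. Pairing the difference of the stationarity
  equations with \<open>x \<epsilon> - x 0\<close> and using the curvature bound shows that this difference is \<open>O(\<epsilon>)\<close>. Caratheodory's
  form of the derivative of \<open>J\<^sub>K'\<close> then turns the equations into a linear system whose matrix converges.
\<close>

lemma difference_quotient_tanh_minimizer:
  assumes K: "K > 0" and c: "c > 0"
    and loc: "\<And>x. (\<And>z. objective 0 (tanh_penalty K) x \<le> objective 0 (tanh_penalty K) z + 1 / K\<^sup>2) \<Longrightarrow> localized K x"
    and curv: "\<And>x v. localized K x \<Longrightarrow>
       c * (norm v)\<^sup>2 \<le> v \<bullet> (A *v v) + (\<Sum>j\<in>UNIV. lam * tanh_penalty_deriv2 K (x $ j) * (v $ j)\<^sup>2)"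
  obtains h where
    "\<And>j. (A *v h) $ j + lam * tanh_penalty_deriv2 K (tanh_minimizer K 0 $ j) * h $ j
        = score_shift (tanh_minimizer K 0) $ j"
    "((\<lambda>\<epsilon>. (1 / \<epsilon>) *\<^sub>R (tanh_minimizer K \<epsilon> - tanh_minimizer K 0)) \<longlongrightarrow> h) (at_right 0)"
proof -
  define x where "x = tanh_minimizer K"
  define y where "y = x 0"
  let ?J = "tanh_penalty K"
  have minx: "objective \<epsilon> ?J (x \<epsilon>) \<le> objective \<epsilon> ?J z" if "0 \<le> \<epsilon>" "\<epsilon> < 1" for \<epsilon> z
    unfolding x_def using K that by (rule tanh_minimizer)
  have Jnn: "0 \<le> ?J t" for t using K by (rule tanh_penalty_nonneg)
  define E where "E = (y\<^sub>0 - a \<bullet> y)\<^sup>2 + 2 * lam * (\<Sum>j\<in>UNIV. ?J (y $ j))"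
  have E: "E \<ge> 0"
    unfolding E_def using Jnn lam_nonneg by (auto intro!: add_nonneg_nonneg mult_nonneg_nonneg sum_nonneg)
  have opt: "objective 0 ?J (x \<epsilon>) \<le> objective 0 ?J z + 2 * \<epsilon> * E" if "0 \<le> \<epsilon>" "\<epsilon> \<le> 1 / 2" for \<epsilon> z
  proof -
    have "objective 0 ?J (x \<epsilon>) \<le> objective 0 ?J y + 2 * \<epsilon> * E"
      unfolding E_def using that by (intro minimizer_contaminated_near_optimal minx Jnn) auto
    also have "objective 0 ?J y \<le> objective 0 ?J z" unfolding y_def by (rule minx) auto
    finally show ?thesis by simp
  qed
  have small: "\<forall>\<^sub>F \<epsilon> in at_right 0. 0 < \<epsilon> \<and> \<epsilon> < u" if "u > 0" for u :: real
    using that by (auto simp: eventually_at_right_field)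
  \<comment> \<open>Up to level \<open>u\<close> the suboptimality \<open>2 \<epsilon> E\<close> stays below the tolerance \<open>1/K\<^sup>2\<close>.\<close>
  define u where "u = min (1 / 2) (1 / K\<^sup>2 / (2 * E + 1))"
  have u: "u > 0" using K E by (auto simp: u_def)
  have locx: "localized K (x \<epsilon>)" if "0 \<le> \<epsilon>" "\<epsilon> \<le> u" for \<epsilon>
  proof (rule loc)
    fix z
    have "\<epsilon> * (2 * E) \<le> \<epsilon> * (2 * E + 1)" using that by (intro mult_left_mono) auto
    also have "\<dots> \<le> 1 / K\<^sup>2 / (2 * E + 1) * (2 * E + 1)"
      using that E by (intro mult_right_mono) (auto simp: u_def)
    also have "\<dots> = 1 / K\<^sup>2" using E by simp
    finally have "2 * \<epsilon> * E \<le> 1 / K\<^sup>2" by (simp add: mult_ac)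
    moreover have "objective 0 ?J (x \<epsilon>) \<le> objective 0 ?J z + 2 * \<epsilon> * E"
      using that by (intro opt) (auto simp: u_def)
    ultimately show "objective 0 ?J (x \<epsilon>) \<le> objective 0 ?J z + 1 / K\<^sup>2" by linarith
  qed
  have locy: "localized K y" unfolding y_def using u by (intro locx) auto
  have eq: "\<epsilon> * score_shift (x \<epsilon>) $ j
      = (A *v (x \<epsilon> - y)) $ j + lam * (tanh_penalty_deriv K (x \<epsilon> $ j) - tanh_penalty_deriv K (y $ j))"
    if "0 \<le> \<epsilon>" "\<epsilon> < 1" for \<epsilon> j
  proof -
    have "score \<epsilon> (x \<epsilon>) $ j - score 0 y $ j = \<epsilon> * score_shift (x \<epsilon>) $ j - (A *v (x \<epsilon> - y)) $ j"
      using arg_cong[OF score_diff[of \<epsilon> "x \<epsilon>" y], of "\<lambda>v. v $ j"] by simp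
    moreover have "score \<epsilon> (x \<epsilon>) $ j = lam * tanh_penalty_deriv K (x \<epsilon> $ j)"
      unfolding x_def using K that by (rule tanh_minimizer_score)
    moreover have "score 0 y $ j = lam * tanh_penalty_deriv K (y $ j)"
      unfolding x_def y_def using K by (intro tanh_minimizer_score) auto
    ultimately show ?thesis by (simp add: right_diff_distrib)
  qed
  obtain B where B: "B > 0" "\<And>x x'. norm (score_shift x) \<le> norm (score_shift x') + B * norm (x - x')"
    by (rule score_shift_lipschitz) blast
  define W where "W = norm (score_shift y)"
  \<comment> \<open>For \<open>\<epsilon> < c / (2 B)\<close> the growth of the score shift is absorbed by half of the curvature.\<close>
  have dist: "norm (x \<epsilon> - y) \<le> 2 * W / c * \<epsilon>" if eps: "0 < \<epsilon>" "\<epsilon> < min u (c / (2 * B))" for \<epsilon>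
  proof -
    have eps1: "0 \<le> \<epsilon>" "\<epsilon> < 1" "\<epsilon> \<le> u" using eps by (auto simp: u_def)
    define d where "d = x \<epsilon> - y"
    define n where "n = norm d"
    obtain \<xi> where \<xi>: "localized K \<xi>"
      "\<And>j. tanh_penalty_deriv K (x \<epsilon> $ j) - tanh_penalty_deriv K (y $ j)
          = tanh_penalty_deriv2 K (\<xi> $ j) * (x \<epsilon> $ j - y $ j)"
      by (rule localized_secant[OF locx locy]) (use eps1 in auto)
    have "c * n\<^sup>2 \<le> d \<bullet> (A *v d) + (\<Sum>j\<in>UNIV. lam * tanh_penalty_deriv2 K (\<xi> $ j) * (d $ j)\<^sup>2)"
      unfolding n_def using \<xi>(1) by (rule curv)
    also have "\<dots> = d \<bullet> (\<epsilon> *\<^sub>R score_shift (x \<epsilon>))"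
      unfolding inner_vec_def sum.distrib[symmetric]
    proof (intro sum.cong refl)
      fix j
      have "\<epsilon> * score_shift (x \<epsilon>) $ j = (A *v d) $ j + lam * (tanh_penalty_deriv2 K (\<xi> $ j) * d $ j)"
        using eq[OF eps1(1,2), of j] unfolding \<xi>(2) by (simp add: d_def)
      then show "d $ j \<bullet> (A *v d) $ j + lam * tanh_penalty_deriv2 K (\<xi> $ j) * (d $ j)\<^sup>2
          = d $ j \<bullet> (\<epsilon> *\<^sub>R score_shift (x \<epsilon>)) $ j"
        by (simp add: power2_eq_square algebra_simps)
    qed
    also have "\<dots> \<le> n * (\<epsilon> * norm (score_shift (x \<epsilon>)))"
      using norm_cauchy_schwarz[of d "\<epsilon> *\<^sub>R score_shift (x \<epsilon>)"] eps by (simp add: n_def)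
    also have "\<dots> \<le> n * (\<epsilon> * (W + B * n))"
      using B(2)[of "x \<epsilon>" y] eps by (intro mult_left_mono) (auto simp: n_def d_def W_def)
    finally have "n * (c * n) \<le> n * (\<epsilon> * (W + B * n))" by (simp add: power2_eq_square algebra_simps)
    moreover have "n \<ge> 0" by (simp add: n_def)
    moreover have W: "W \<ge> 0" by (simp add: W_def)
    ultimately have "n = 0 \<or> c * n \<le> \<epsilon> * (W + B * n)" by (simp add: mult_le_cancel_left) linarith
    then show ?thesis
    proof
      assume "n = 0"
      then show ?thesis using W c eps by (simp add: n_def d_def)
    next
      assume *: "c * n \<le> \<epsilon> * (W + B * n)"
      have "\<epsilon> * B \<le> c / 2" using eps B(1) by (simp add: field_simps)
      then have "\<epsilon> * B * n \<le> c / 2 * n" using \<open>n \<ge> 0\<close> by (rule mult_right_mono)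
      with * have "c / 2 * n \<le> \<epsilon> * W" by (simp add: algebra_simps)
      then show ?thesis using c by (simp add: n_def d_def field_simps)
    qed
  qed
  have "min u (c / (2 * B)) > 0" using u c B by simp
  note ev = small[OF this]
  have "((\<lambda>\<epsilon>. x \<epsilon> - y) \<longlongrightarrow> 0) (at_right 0)"
  proof (rule Lim_null_comparison)
    show "\<forall>\<^sub>F \<epsilon> in at_right 0. norm (x \<epsilon> - y) \<le> 2 * W / c * \<epsilon>"
      using ev by eventually_elim (rule dist, auto)
    show "((\<lambda>\<epsilon>. 2 * W / c * \<epsilon>) \<longlongrightarrow> 0) (at_right 0)"
      by (intro tendsto_mult_right_zero tendsto_ident_at)
  qed
  then have lim: "(x \<longlongrightarrow> y) (at_right 0)" by (rule Lim_null[THEN iffD2])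
  have "\<forall>j. \<exists>g. (\<forall>t. tanh_penalty_deriv K t - tanh_penalty_deriv K (y $ j) = g t * (t - y $ j))
      \<and> isCont g (y $ j) \<and> g (y $ j) = tanh_penalty_deriv2 K (y $ j)"
    using tanh_penalty_deriv2 unfolding CARAT_DERIV[symmetric] by blast
  then obtain g where g: "\<And>j t. tanh_penalty_deriv K t - tanh_penalty_deriv K (y $ j) = g j t * (t - y $ j)"
    "\<And>j. isCont (g j) (y $ j)" "\<And>j. g j (y $ j) = tanh_penalty_deriv2 K (y $ j)"
    by metis
  define M where "M \<epsilon> = (\<chi> i j. A $ i $ j + (if i = j then lam * g i (x \<epsilon> $ i) else 0))" for \<epsilon>
  define L where "L = (\<chi> i j. A $ i $ j + (if i = j then lam * tanh_penalty_deriv2 K (y $ i) else 0))"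
  have L: "(L *v v) $ i = (A *v v) $ i + lam * tanh_penalty_deriv2 K (y $ i) * v $ i" for v i
    unfolding L_def by (rule add_diag_mult_component)
  have ker: "v = 0" if "L *v v = 0" for v
  proof -
    have "0 = v \<bullet> (L *v v)" using that by simp
    also have "\<dots> = v \<bullet> (A *v v) + (\<Sum>j\<in>UNIV. lam * tanh_penalty_deriv2 K (y $ j) * (v $ j)\<^sup>2)"
      unfolding inner_vec_def sum.distrib[symmetric]
      by (intro sum.cong refl) (simp add: L power2_eq_square algebra_simps)
    also have "\<dots> \<ge> c * (norm v)\<^sup>2" by (rule curv[OF locy])
    finally have "(norm v)\<^sup>2 \<le> 0" using c by (simp add: mult_le_0_iff)
    then show ?thesis by simp
  qed
  obtain h where h: "L *v h = score_shift y"
  proof -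
    obtain L' where "L ** L' = mat 1"
      using invertible_if_trivial_kernel[OF ker] by (auto simp: invertible_def)
    then have "L *v (L' *v score_shift y) = score_shift y"
      by (simp add: matrix_vector_mul_assoc)
    then show ?thesis by (rule that)
  qed
  have "((\<lambda>\<epsilon>. (1 / \<epsilon>) *\<^sub>R (x \<epsilon> - y)) \<longlongrightarrow> h) (at_right 0)"
  proof (rule linear_system_limit[where M = M and L = L and w = "\<lambda>\<epsilon>. score_shift (x \<epsilon>)"])
    fix i j
    have "((\<lambda>\<epsilon>. g i (x \<epsilon> $ i)) \<longlongrightarrow> g i (y $ i)) (at_right 0)"
      by (rule isCont_tendsto_compose[OF g(2) tendsto_vec_nth[OF lim]])
    then have "((\<lambda>\<epsilon>. lam * g i (x \<epsilon> $ i)) \<longlongrightarrow> lam * tanh_penalty_deriv2 K (y $ i)) (at_right 0)"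
      unfolding g(3) by (rule tendsto_mult_left)
    then show "((\<lambda>\<epsilon>. M \<epsilon> $ i $ j) \<longlongrightarrow> L $ i $ j) (at_right 0)"
      unfolding M_def L_def by (cases "i = j") (auto intro!: tendsto_intros)
  next
    have "isCont score_shift y"
      using continuous_on_score_shift by (simp add: continuous_on_eq_continuous_at)
    then show "((\<lambda>\<epsilon>. score_shift (x \<epsilon>)) \<longlongrightarrow> L *v h) (at_right 0)"
      unfolding h using lim by (rule isCont_tendsto_compose)
  next
    show "\<forall>\<^sub>F \<epsilon> in at_right 0. M \<epsilon> *v (1 / \<epsilon>) *\<^sub>R (x \<epsilon> - y) = score_shift (x \<epsilon>)"
      using small[OF zero_less_one]
    proof eventually_elim
      case (elim \<epsilon>)
      have "(M \<epsilon> *v (x \<epsilon> - y)) $ j = \<epsilon> * score_shift (x \<epsilon>) $ j" for j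
        unfolding M_def add_diag_mult_component using eq[of \<epsilon> j] elim by (simp add: g(1) mult.assoc)
      then have "M \<epsilon> *v (x \<epsilon> - y) = \<epsilon> *\<^sub>R score_shift (x \<epsilon>)" by (simp add: vec_eq_iff)
      then show ?case using elim by (simp add: matrix_vector_mult_scaleR)
    qed
  qed (rule ker)
  then show ?thesis
  proof (intro that[of h])
    show "(A *v h) $ j + lam * tanh_penalty_deriv2 K (tanh_minimizer K 0 $ j) * h $ j
        = score_shift (tanh_minimizer K 0) $ j" for j
      using L[of h j] by (simp add: h x_def y_def)
  qed (simp add: x_def y_def)
qed

lemma tanh_influence_exists:
  "\<forall>\<^sub>F K in at_top. \<exists>h.
     (\<forall>j. (A *v h) $ j + lam * tanh_penalty_deriv2 K (tanh_minimizer K 0 $ j) * h $ j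
        = score_shift (tanh_minimizer K 0) $ j)
     \<and> ((\<lambda>\<epsilon>. (1 / \<epsilon>) *\<^sub>R (tanh_minimizer K \<epsilon> - tanh_minimizer K 0)) \<longlongrightarrow> h) (at_right 0)"
proof -
  obtain c where c: "c > 0"
    "\<forall>\<^sub>F K in at_top. \<forall>x. localized K x \<longrightarrow> (\<forall>v.
       c * (norm v)\<^sup>2 \<le> v \<bullet> (A *v v) + (\<Sum>j\<in>UNIV. lam * tanh_penalty_deriv2 K (x $ j) * (v $ j)\<^sup>2))"
    by (rule localized_curvature) blast
  from near_optimal_localized c(2) eventually_gt_at_top[of 0]
  show ?thesis
  proof eventually_elim
    case (elim K)
    show ?case
      by (rule difference_quotient_tanh_minimizer[of K c]) (use elim c(1) in blast)+
  qed
qed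

lemma tanh_minimizer_localized: "\<forall>\<^sub>F K in at_top. localized K (tanh_minimizer K 0)"
  using near_optimal_localized eventually_gt_at_top[of 0]
proof eventually_elim
  case (elim K)
  have "objective 0 (tanh_penalty K) (tanh_minimizer K 0) \<le> objective 0 (tanh_penalty K) z + 1 / K\<^sup>2" for z
  proof -
    have "objective 0 (tanh_penalty K) (tanh_minimizer K 0) \<le> objective 0 (tanh_penalty K) z"
      using elim by (intro tanh_minimizer) auto
    then show ?thesis by (simp add: add_increasing2)
  qed
  with elim show ?case by blast
qed

text \<open>
  One square matrix for both parts of the limiting system, the equations of the active block and the vanishing
  of the inactive coordinates.
\<close>

definition active_rows :: "real ^ 'p ^ 'p" where
  "active_rows = (\<chi> i j. if \<beta>s $ i = 0 then (if i = j then 1 else 0) else A $ i $ j)"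

lemma active_rows_mult:
  "(active_rows *v v) $ i = (if \<beta>s $ i = 0 then v $ i else (A *v v) $ i)"
  by (simp add: active_rows_def matrix_vector_mult_def if_distrib[of "\<lambda>u. u * _"] cong: if_cong)

lemma active_rows_kernel:
  assumes "active_rows *v v = 0"
  shows "v = 0"
proof (rule ccontr)
  assume v: "v \<noteq> 0"
  have eq: "(if \<beta>s $ i = 0 then v $ i else (A *v v) $ i) = 0" for i
    using assms active_rows_mult[of v i] by simp
  have supp: "v $ i = 0" if "\<beta>s $ i = 0" for i using eq[of i] that by simp
  have "v \<bullet> (A *v v) = 0"
    unfolding inner_vec_def
  proof (intro sum.neutral ballI)
    fix i show "v $ i \<bullet> (A *v v) $ i = 0" using eq[of i] by (cases "\<beta>s $ i = 0") simp_all
  qed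
  with active_block_pd[OF v supp] show False by simp
qed

lemma active_rows_solution:
  assumes "\<And>j. \<beta>s $ j = 0 \<Longrightarrow> h $ j = 0" "\<And>j. \<beta>s $ j \<noteq> 0 \<Longrightarrow> (A *v h) $ j = score_shift \<beta>s $ j"
  shows "active_rows *v h = (\<chi> j. if \<beta>s $ j = 0 then 0 else score_shift \<beta>s $ j)"
  using assms by (simp add: vec_eq_iff active_rows_mult)

text \<open>
  The diagonal entries \<open>lam J\<^sub>K''\<close> at inactive coordinates diverge, so the matrices have no limit. Dividing each
  inactive row by its diverging diagonal entry gives an equivalent system which converges to \<open>active_rows\<close>.
\<close>

lemma tanh_influence_tendsto:
  assumes sol: "\<forall>\<^sub>F K in at_top. \<forall>j.
      (A *v h K) $ j + lam * tanh_penalty_deriv2 K (tanh_minimizer K 0 $ j) * h K $ j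
        = score_shift (tanh_minimizer K 0) $ j"
    and lim: "\<And>j. \<beta>s $ j = 0 \<Longrightarrow> h' $ j = 0" "\<And>j. \<beta>s $ j \<noteq> 0 \<Longrightarrow> (A *v h') $ j = score_shift \<beta>s $ j"
  shows "(h \<longlongrightarrow> h') at_top"
proof -
  define y where "y K = tanh_minimizer K 0" for K
  define D where "D K j = lam * tanh_penalty_deriv2 K (y K $ j)" for K j
  obtain m where m: "m > 0" "\<And>j. \<beta>s $ j \<noteq> 0 \<Longrightarrow> m \<le> \<bar>\<beta>s $ j\<bar>" by (rule active_margin) blast
  have loc: "\<forall>\<^sub>F K in at_top. localized K (y K)"
    unfolding y_def by (rule tanh_minimizer_localized)
  have D_active: "((\<lambda>K. D K j) \<longlongrightarrow> 0) at_top" if j: "\<beta>s $ j \<noteq> 0" for j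
  proof (rule Lim_null_comparison)
    show "\<forall>\<^sub>F K in at_top. norm (D K j) \<le> lam * (27 / (m / 2)\<^sup>2) * (1 / K)"
      using loc eventually_gt_at_top[of 0]
    proof eventually_elim
      case (elim K)
      have "lam * \<bar>tanh_penalty_deriv2 K (y K $ j)\<bar> \<le> lam * (27 / (m / 2)\<^sup>2 / K)"
        using curvature_at_active[OF elim(2,1) j m(1) m(2)[OF j]] lam_nonneg by (rule mult_left_mono)
      then show ?case using lam_nonneg by (simp add: D_def abs_mult mult.commute)
    qed
    have "((\<lambda>K :: real. 1 / K) \<longlongrightarrow> 0) at_top"
      by (rule tendsto_divide_0[OF tendsto_const filterlim_at_top_imp_at_infinity[OF filterlim_ident]])
    then show "((\<lambda>K. lam * (27 / (m / 2)\<^sup>2) * (1 / K)) \<longlongrightarrow> 0) at_top"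
      by (rule tendsto_mult_right_zero)
  qed
  have D_inactive: "((\<lambda>K. 1 / D K j) \<longlongrightarrow> 0) at_top" "\<forall>\<^sub>F K in at_top. D K j \<noteq> 0"
    if j: "\<beta>s $ j = 0" for j
  proof -
    have lam: "lam > 0" using j by (rule penalized_if_inactive)
    have ev: "\<forall>\<^sub>F K in at_top. lam * central_curvature * K \<le> D K j"
      using loc eventually_gt_at_top[of 0]
    proof eventually_elim
      case (elim K)
      have "central_curvature * K \<le> tanh_penalty_deriv2 K (y K $ j)"
        using elim(2,1) j by (rule curvature_at_inactive)
      then show ?case unfolding D_def using lam by (simp add: mult.assoc)
    qed
    have "filterlim (\<lambda>K. lam * central_curvature * K) at_top at_top"
      using lam central_curvature_pos
      by (intro filterlim_tendsto_pos_mult_at_top[OF tendsto_const] filterlim_ident) auto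
    then have D: "filterlim (\<lambda>K. D K j) at_top at_top"
      by (rule filterlim_at_top_mono) (rule ev)
    then show "((\<lambda>K. 1 / D K j) \<longlongrightarrow> 0) at_top"
      by (intro tendsto_divide_0[OF tendsto_const] filterlim_at_top_imp_at_infinity)
    from D show "\<forall>\<^sub>F K in at_top. D K j \<noteq> 0"
      unfolding filterlim_at_top_dense by (rule allE[of _ 0]) (auto elim: eventually_mono)
  qed
  define s where "s K j = (if \<beta>s $ j = 0 then 1 / D K j else 1)" for K j
  define M where "M K = (\<chi> i j. s K i * A $ i $ j + (if i = j then s K i * D K i else 0))" for K
  define w where "w K = (\<chi> i. s K i * score_shift (y K) $ i)" for K
  have M_mult: "(M K *v v) $ i = s K i * ((A *v v) $ i + D K i * v $ i)" for K v i
  proof -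
    have "(M K *v v) $ i = ((\<chi> i j. s K i * A $ i $ j) *v v) $ i + s K i * D K i * v $ i"
      unfolding M_def using add_diag_mult_component[of "\<chi> i j. s K i * A $ i $ j" "\<lambda>i. s K i * D K i" v i]
      by simp
    also have "((\<chi> i j. s K i * A $ i $ j) *v v) $ i = s K i * (A *v v) $ i"
      by (simp add: matrix_vector_mult_def sum_distrib_left mult.assoc)
    finally show ?thesis by (simp add: algebra_simps)
  qed
  show ?thesis
  proof (rule linear_system_limit[where M = M and L = active_rows and w = w])
    fix i j
    show "((\<lambda>K. M K $ i $ j) \<longlongrightarrow> active_rows $ i $ j) at_top"
    proof (cases "\<beta>s $ i = 0")
      case True
      have "((\<lambda>K. 1 / D K i * A $ i $ j) \<longlongrightarrow> 0) at_top"
        by (rule tendsto_mult_left_zero[OF D_inactive(1)[OF True]])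
      then have "((\<lambda>K. 1 / D K i * A $ i $ j + (if i = j then 1 else 0)) \<longlongrightarrow> 0 + (if i = j then 1 else 0)) at_top"
        by (intro tendsto_add tendsto_const)
      moreover have "\<forall>\<^sub>F K in at_top. 1 / D K i * A $ i $ j + (if i = j then 1 else 0) = M K $ i $ j"
        using D_inactive(2)[OF True] by eventually_elim (use True in \<open>auto simp: M_def s_def\<close>)
      ultimately show ?thesis
        using True by (simp add: active_rows_def Lim_transform_eventually)
    next
      case False
      have "((\<lambda>K. A $ i $ j + (if i = j then D K i else 0)) \<longlongrightarrow> A $ i $ j + 0) at_top"
        using D_active[OF False] by (intro tendsto_add tendsto_const) (cases "i = j"; simp)
      then show ?thesis using False by (cases "i = j") (simp_all add: M_def s_def active_rows_def)
    qed
  next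
    fix v assume "active_rows *v v = 0"
    then show "v = 0" by (rule active_rows_kernel)
  next
    have "isCont score_shift \<beta>s"
      using continuous_on_score_shift by (simp add: continuous_on_eq_continuous_at)
    then have W: "((\<lambda>K. score_shift (y K)) \<longlongrightarrow> score_shift \<beta>s) at_top"
      unfolding y_def using tanh_minimizer_tendsto_lasso by (rule isCont_tendsto_compose)
    have rows: "active_rows *v h' = (\<chi> j. if \<beta>s $ j = 0 then 0 else score_shift \<beta>s $ j)"
      by (rule active_rows_solution[OF lim])
    show "(w \<longlongrightarrow> active_rows *v h') at_top"
    proof (rule vec_tendstoI)
      fix i
      show "((\<lambda>K. w K $ i) \<longlongrightarrow> (active_rows *v h') $ i) at_top"
      proof (cases "\<beta>s $ i = 0")
        case True
        then show ?thesis
          using tendsto_mult[OF D_inactive(1)[OF True] tendsto_vec_nth[OF W, of i]]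
          by (simp add: w_def s_def rows)
      next
        case False
        then show ?thesis using tendsto_vec_nth[OF W, of i] by (simp add: w_def s_def rows)
      qed
    qed
  next
    show "\<forall>\<^sub>F K in at_top. M K *v h K = w K"
      using sol by eventually_elim (simp add: vec_eq_iff M_mult w_def D_def y_def)
  qed
qed

text \<open>
  Whichever minimizer \<open>arg_min\<close> selects at level \<open>\<epsilon>\<close>, it is optimal up to \<open>O(\<epsilon>)\<close> at level \<open>0\<close>, and nearly optimal
  points are close to \<open>\<beta>s\<close>.
\<close>

lemma lasso_minimizer_tendsto: "(lasso_minimizer \<longlongrightarrow> \<beta>s) (at_right 0)"
proof (rule tendsto_lasso)
  define E where "E = (y\<^sub>0 - a \<bullet> \<beta>s)\<^sup>2 + 2 * lam * (\<Sum>j\<in>UNIV. \<bar>\<beta>s $ j\<bar>)"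
  have small: "\<forall>\<^sub>F \<epsilon> in at_right 0. 0 < \<epsilon> \<and> \<epsilon> < (1 / 2 :: real)"
    unfolding eventually_at_right_field by (intro exI[of _ "1 / 2"]) simp
  show "((\<lambda>\<epsilon>. objective 0 abs (lasso_minimizer \<epsilon>)) \<longlongrightarrow> objective 0 abs \<beta>s) (at_right 0)"
  proof (rule tendsto_sandwich)
    show "\<forall>\<^sub>F \<epsilon> in at_right 0. objective 0 abs \<beta>s \<le> objective 0 abs (lasso_minimizer \<epsilon>)"
      by (intro always_eventually allI lasso_optimal)
    show "\<forall>\<^sub>F \<epsilon> in at_right 0. objective 0 abs (lasso_minimizer \<epsilon>) \<le> objective 0 abs \<beta>s + 2 * \<epsilon> * E"
      using small
    proof eventually_elim
      case (elim \<epsilon>)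
      show ?case unfolding E_def
        using elim by (intro minimizer_contaminated_near_optimal lasso_minimizer) auto
    qed
    have "((\<lambda>\<epsilon>. objective 0 abs \<beta>s + 2 * \<epsilon> * E) \<longlongrightarrow> objective 0 abs \<beta>s + 2 * 0 * E) (at_right 0)"
      by (intro tendsto_intros)
    then show "((\<lambda>\<epsilon>. objective 0 abs \<beta>s + 2 * \<epsilon> * E) \<longlongrightarrow> objective 0 abs \<beta>s) (at_right 0)" by simp
  qed (rule tendsto_const)
qed

text \<open>
  Near \<open>\<beta>s\<close> a nonzero inactive coordinate of a minimizer would force \<open>\<bar>score\<bar> = lam\<close>, which strictness and continuity
  exclude. At active coordinates the penalty has constant derivative, so it drops out of the difference of the
  stationarity equations and the difference quotient solves an \<open>active_rows\<close> system with fixed matrix.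
\<close>

lemma difference_quotient_lasso:
  assumes strict: "\<And>j. \<beta>s $ j = 0 \<Longrightarrow> \<bar>score 0 \<beta>s $ j\<bar> < lam"
    and lim: "\<And>j. \<beta>s $ j = 0 \<Longrightarrow> h' $ j = 0" "\<And>j. \<beta>s $ j \<noteq> 0 \<Longrightarrow> (A *v h') $ j = score_shift \<beta>s $ j"
  shows "((\<lambda>\<epsilon>. (1 / \<epsilon>) *\<^sub>R (lasso_minimizer \<epsilon> - \<beta>s)) \<longlongrightarrow> h') (at_right 0)"
proof -
  define x where "x = lasso_minimizer"
  have x: "(x \<longlongrightarrow> \<beta>s) (at_right 0)" unfolding x_def by (rule lasso_minimizer_tendsto)
  have small: "\<forall>\<^sub>F \<epsilon> in at_right 0. 0 < \<epsilon> \<and> \<epsilon> < (1 :: real)"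
    unfolding eventually_at_right_field by (intro exI[of _ 1]) simp
  have "isCont score_shift \<beta>s"
    using continuous_on_score_shift by (simp add: continuous_on_eq_continuous_at)
  then have W: "((\<lambda>\<epsilon>. score_shift (x \<epsilon>)) \<longlongrightarrow> score_shift \<beta>s) (at_right 0)"
    using x by (rule isCont_tendsto_compose)
  have sc: "((\<lambda>\<epsilon>. score \<epsilon> (x \<epsilon>)) \<longlongrightarrow> score 0 \<beta>s) (at_right 0)"
  proof -
    have "((\<lambda>\<epsilon>. A *v x \<epsilon>) \<longlongrightarrow> A *v \<beta>s) (at_right 0)"
      by (rule bounded_linear.tendsto[OF matrix_vector_mul_bounded_linear x])
    then show ?thesis unfolding score_def by (intro tendsto_intros W)
  qed
  have stat: "score \<epsilon> (x \<epsilon>) $ j = lam * sgn (x \<epsilon> $ j)" if "0 < \<epsilon>" "\<epsilon> < 1" "x \<epsilon> $ j \<noteq> 0" for \<epsilon> j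
    using stationary[OF lasso_minimizer has_real_derivative_abs, of \<epsilon> j] that by (simp add: x_def)
  have row: "\<forall>\<^sub>F \<epsilon> in at_right 0. (active_rows *v (x \<epsilon> - \<beta>s)) $ j
      = (if \<beta>s $ j = 0 then 0 else \<epsilon> * score_shift (x \<epsilon>) $ j)" for j
  proof (cases "\<beta>s $ j = 0")
    case True
    have "\<forall>\<^sub>F \<epsilon> in at_right 0. \<bar>score \<epsilon> (x \<epsilon>) $ j\<bar> < lam"
      by (rule order_tendstoD(2)[OF tendsto_rabs[OF tendsto_vec_nth[OF sc]] strict[OF True]])
    with small show ?thesis
    proof eventually_elim
      case (elim \<epsilon>)
      have "x \<epsilon> $ j = 0"
      proof (rule ccontr)
        assume "x \<epsilon> $ j \<noteq> 0"
        with stat[of \<epsilon> j] elim lam_nonneg show False by (simp add: abs_mult)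
      qed
      then show ?case using True by (simp add: active_rows_mult)
    qed
  next
    case False
    have sgn: "\<forall>\<^sub>F \<epsilon> in at_right 0. x \<epsilon> $ j \<noteq> 0 \<and> sgn (x \<epsilon> $ j) = sgn (\<beta>s $ j)"
    proof (cases "\<beta>s $ j > 0")
      case True
      have "\<forall>\<^sub>F \<epsilon> in at_right 0. x \<epsilon> $ j > 0"
        by (rule order_tendstoD(1)[OF tendsto_vec_nth[OF x] True])
      then show ?thesis by eventually_elim (use True in simp)
    next
      case neg: False
      then have neg: "\<beta>s $ j < 0" using False by simp
      have "\<forall>\<^sub>F \<epsilon> in at_right 0. x \<epsilon> $ j < 0"
        by (rule order_tendstoD(2)[OF tendsto_vec_nth[OF x] neg])
      then show ?thesis by eventually_elim (use neg in simp)
    qed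
    from small sgn show ?thesis
    proof eventually_elim
      case (elim \<epsilon>)
      have "score \<epsilon> (x \<epsilon>) $ j - score 0 \<beta>s $ j = 0"
        using stat[of \<epsilon> j] elim active_score[OF False] by simp
      then have "(A *v (x \<epsilon> - \<beta>s)) $ j = \<epsilon> * score_shift (x \<epsilon>) $ j"
        using arg_cong[OF score_diff[of \<epsilon> "x \<epsilon>" \<beta>s], of "\<lambda>v. v $ j"] by simp
      then show ?case using False by (simp add: active_rows_mult)
    qed
  qed
  have "((\<lambda>\<epsilon>. (1 / \<epsilon>) *\<^sub>R (x \<epsilon> - \<beta>s)) \<longlongrightarrow> h') (at_right 0)"
  proof (rule linear_system_limit[where M = "\<lambda>_. active_rows" and L = active_rows
        and w = "\<lambda>\<epsilon>. \<chi> j. if \<beta>s $ j = 0 then 0 else score_shift (x \<epsilon>) $ j"])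
    show "((\<lambda>\<epsilon>. \<chi> j. if \<beta>s $ j = 0 then 0 else score_shift (x \<epsilon>) $ j) \<longlongrightarrow> active_rows *v h') (at_right 0)"
      by (rule vec_tendstoI) (use tendsto_vec_nth[OF W] in \<open>auto simp: active_rows_solution[OF lim]\<close>)
    have "\<forall>\<^sub>F \<epsilon> in at_right 0. \<forall>j. (active_rows *v (x \<epsilon> - \<beta>s)) $ j
      = (if \<beta>s $ j = 0 then 0 else \<epsilon> * score_shift (x \<epsilon>) $ j)"
      by (rule eventually_all_finite[OF row])
    with small show "\<forall>\<^sub>F \<epsilon> in at_right 0. active_rows *v (1 / \<epsilon>) *\<^sub>R (x \<epsilon> - \<beta>s)
        = (\<chi> j. if \<beta>s $ j = 0 then 0 else score_shift (x \<epsilon>) $ j)"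
      by eventually_elim (auto simp: matrix_vector_mult_scaleR vec_eq_iff)
  qed (use active_rows_kernel in auto)
  then show ?thesis by (simp add: x_def)
qed

end

section \<open>Second moments of contaminated laws\<close>

lemma nn_integral_contaminate:
  assumes "f \<in> borel_measurable H" and z: "z \<in> space H"
  shows "(\<integral>\<^sup>+ x. f x \<partial>contaminate \<epsilon> H z) = ennreal (1 - \<epsilon>) * (\<integral>\<^sup>+ x. f x \<partial>H) + ennreal \<epsilon> * f z"
  using assms(1)
proof (induct f rule: borel_measurable_induct)
  case (cong f g)
  have "(\<integral>\<^sup>+ x. g x \<partial>contaminate \<epsilon> H z) = (\<integral>\<^sup>+ x. f x \<partial>contaminate \<epsilon> H z)"
    "(\<integral>\<^sup>+ x. g x \<partial>H) = (\<integral>\<^sup>+ x. f x \<partial>H)"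
    using cong(3) by (auto intro!: nn_integral_cong)
  then show ?case using cong(3)[OF z] cong(4) by simp
next
  case (set B)
  then show ?case
    by (simp add: emeasure_contaminate)
next
  case (mult u r)
  then show ?case
    by (simp add: nn_integral_cmult distrib_left mult_ac)
next
  case (add u v)
  then show ?case
    by (simp add: nn_integral_add distrib_left add_ac)
next
  case (seq U)
  have U: "incseq U" "\<And>i. U i \<in> borel_measurable H" using seq by auto
  have mono: "incseq (\<lambda>i. ennreal (1 - \<epsilon>) * (\<integral>\<^sup>+ x. U i x \<partial>H))" "incseq (\<lambda>i. ennreal \<epsilon> * U i z)"
    using U(1) by (auto simp: incseq_def le_fun_def intro!: mult_left_mono nn_integral_mono)
  have "(\<integral>\<^sup>+ x. (SUP i. U i x) \<partial>contaminate \<epsilon> H z) = (SUP i. \<integral>\<^sup>+ x. U i x \<partial>contaminate \<epsilon> H z)"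
    using U by (intro nn_integral_monotone_convergence_SUP) auto
  also have "\<dots> = (SUP i. ennreal (1 - \<epsilon>) * (\<integral>\<^sup>+ x. U i x \<partial>H) + ennreal \<epsilon> * U i z)"
    using seq by simp
  also have "\<dots> = (SUP i. ennreal (1 - \<epsilon>) * (\<integral>\<^sup>+ x. U i x \<partial>H)) + (SUP i. ennreal \<epsilon> * U i z)"
    by (rule ennreal_SUP_add[OF mono])
  also have "\<dots> = ennreal (1 - \<epsilon>) * (\<integral>\<^sup>+ x. (SUP i. U i x) \<partial>H) + ennreal \<epsilon> * (SUP i. U i z)"
    using U by (simp add: SUP_mult_left_ennreal nn_integral_monotone_convergence_SUP)
  finally show ?case by (simp add: image_comp SUP_apply)
qed

lemma integral_contaminate:
  fixes f :: "'b \<Rightarrow> real"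
  assumes f: "integrable H f" and z: "z \<in> space H" and eps: "0 \<le> \<epsilon>" "\<epsilon> \<le> 1"
  shows "(\<integral>x. f x \<partial>contaminate \<epsilon> H z) = (1 - \<epsilon>) * (\<integral>x. f x \<partial>H) + \<epsilon> * f z"
proof -
  have [measurable]: "f \<in> borel_measurable H" using f by simp
  have nn: "(\<integral>\<^sup>+ x. ennreal (g x) \<partial>contaminate \<epsilon> H z)
      = ennreal (1 - \<epsilon>) * (\<integral>\<^sup>+ x. ennreal (g x) \<partial>H) + ennreal \<epsilon> * ennreal (g z)"
    if "g \<in> borel_measurable H" for g :: "'b \<Rightarrow> real"
    using that z by (intro nn_integral_contaminate) auto
  have fin: "(\<integral>\<^sup>+ x. ennreal (f x) \<partial>H) < \<infinity>" "(\<integral>\<^sup>+ x. ennreal (- f x) \<partial>H) < \<infinity>"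
    using f by (auto simp: real_integrable_def less_top)
  have fin_norm: "(\<integral>\<^sup>+ x. ennreal (norm (f x)) \<partial>H) < \<infinity>"
    using f by (simp add: integrable_iff_bounded)
  have "integrable (contaminate \<epsilon> H z) f"
    using fin_norm eps by (auto simp: integrable_iff_bounded nn ennreal_mult_less_top)
  then have "(\<integral>x. f x \<partial>contaminate \<epsilon> H z) =
      enn2real (ennreal (1 - \<epsilon>) * (\<integral>\<^sup>+ x. ennreal (f x) \<partial>H) + ennreal \<epsilon> * ennreal (f z))
      - enn2real (ennreal (1 - \<epsilon>) * (\<integral>\<^sup>+ x. ennreal (- f x) \<partial>H) + ennreal \<epsilon> * ennreal (- f z))"
    by (simp add: real_lebesgue_integral_def nn)
  also have "\<dots> = ((1 - \<epsilon>) * enn2real (\<integral>\<^sup>+ x. ennreal (f x) \<partial>H) + \<epsilon> * max 0 (f z))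
      - ((1 - \<epsilon>) * enn2real (\<integral>\<^sup>+ x. ennreal (- f x) \<partial>H) + \<epsilon> * max 0 (- f z))"
    using fin eps
    by (subst (1 2) enn2real_plus) (auto simp: enn2real_mult ennreal_mult_less_top max_def ennreal_neg)
  also have "\<dots> = (1 - \<epsilon>) * (\<integral>x. f x \<partial>H) + \<epsilon> * f z"
    by (simp add: real_lebesgue_integral_def[OF f] algebra_simps max_def)
  finally show ?thesis .
qed

definition gram_matrix :: "((real ^ 'p) \<times> real) measure \<Rightarrow> real ^ 'p ^ 'p" where
  "gram_matrix H = (\<chi> i j. \<integral>(x, y). x $ i * x $ j \<partial>H)"

definition cross_moment :: "((real ^ 'p) \<times> real) measure \<Rightarrow> real ^ 'p" where
  "cross_moment H = (\<chi> i. \<integral>(x, y). x $ i * y \<partial>H)"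

locale square_integrable_law =
  fixes H :: "((real ^ 'p) \<times> real) measure"
  assumes sets_H [measurable_cong]: "sets H = sets borel"
    and covariate: "integrable H (\<lambda>(x, y). (norm x)\<^sup>2)"
    and response: "integrable H (\<lambda>(x, y). y\<^sup>2)"
begin

lemma integrable_covariate_product: "integrable H (\<lambda>(x, y). x $ i * x $ j)"
proof (rule Bochner_Integration.integrable_bound[OF covariate])
  show "(\<lambda>(x, y). x $ i * x $ j) \<in> borel_measurable H"
    unfolding measurable_cong_sets[OF sets_H refl] case_prod_beta
    by (intro borel_measurable_continuous_onI continuous_intros)
  have "\<bar>x $ i * x $ j\<bar> \<le> (norm x)\<^sup>2" for x :: "real ^ 'p"
    unfolding abs_mult power2_eq_square by (intro mult_mono component_le_norm_cart) auto
  then show "AE p in H. norm (case p of (x, y) \<Rightarrow> x $ i * x $ j) \<le> norm (case p of (x, y) \<Rightarrow> (norm x)\<^sup>2)"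
    by auto
qed

lemma integrable_covariate_response: "integrable H (\<lambda>(x, y). x $ i * y)"
proof (rule Bochner_Integration.integrable_bound[OF Bochner_Integration.integrable_add[OF covariate response]])
  show "(\<lambda>(x, y). x $ i * y) \<in> borel_measurable H"
    unfolding measurable_cong_sets[OF sets_H refl] case_prod_beta
    by (intro borel_measurable_continuous_onI continuous_intros)
  have "\<bar>x $ i * y\<bar> \<le> (norm x)\<^sup>2 + y\<^sup>2" for x :: "real ^ 'p" and y :: real
  proof -
    have "\<bar>x $ i * y\<bar> \<le> norm x * \<bar>y\<bar>"
      unfolding abs_mult by (intro mult_right_mono component_le_norm_cart) auto
    moreover have "2 * (norm x * \<bar>y\<bar>) \<le> (norm x)\<^sup>2 + \<bar>y\<bar>\<^sup>2"
      using sum_squares_bound[of "norm x" "\<bar>y\<bar>"] by simp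
    moreover have "0 \<le> norm x * \<bar>y\<bar>" by simp
    ultimately show ?thesis by simp
  qed
  then show "AE p in H. norm (case p of (x, y) \<Rightarrow> x $ i * y)
      \<le> norm ((case p of (x, y) \<Rightarrow> (norm x)\<^sup>2) + (case p of (x, y) \<Rightarrow> y\<^sup>2))"
    by auto
qed

lemma has_integral_quadratic:
  "integrable H (\<lambda>(x, y). (x \<bullet> v)\<^sup>2) \<and> (\<integral>(x, y). (x \<bullet> v)\<^sup>2 \<partial>H) = v \<bullet> (gram_matrix H *v v)"
proof -
  have eq: "(\<lambda>(x, y :: real). (x \<bullet> v)\<^sup>2) = (\<lambda>p. \<Sum>i\<in>UNIV. \<Sum>j\<in>UNIV. v $ i * v $ j * (case p of (x, y) \<Rightarrow> x $ i * x $ j))"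
    by (auto simp: fun_eq_iff inner_vec_def power2_eq_square sum_product mult_ac)
  have "v \<bullet> (gram_matrix H *v v) = (\<Sum>i\<in>UNIV. \<Sum>j\<in>UNIV. v $ i * v $ j * (\<integral>(x, y). x $ i * x $ j \<partial>H))"
    by (simp add: inner_vec_def matrix_vector_mult_def gram_matrix_def sum_distrib_left mult_ac)
  then show ?thesis
    unfolding eq using integrable_covariate_product
    by (auto intro!: Bochner_Integration.integrable_sum simp: Bochner_Integration.integral_sum)
qed

lemma has_integral_covariate_inner_response:
  "integrable H (\<lambda>(x, y). (x \<bullet> v) * y) \<and> (\<integral>(x, y). (x \<bullet> v) * y \<partial>H) = cross_moment H \<bullet> v"
proof -
  have eq: "(\<lambda>(x, y). (x \<bullet> v) * y) = (\<lambda>p. \<Sum>i\<in>UNIV. v $ i * (case p of (x, y) \<Rightarrow> x $ i * y))"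
    by (auto simp: fun_eq_iff inner_vec_def sum_distrib_left mult_ac)
  have "cross_moment H \<bullet> v = (\<Sum>i\<in>UNIV. v $ i * (\<integral>(x, y). x $ i * y \<partial>H))"
    by (simp add: inner_vec_def cross_moment_def mult_ac)
  then show ?thesis
    unfolding eq using integrable_covariate_response
    by (auto intro!: Bochner_Integration.integrable_sum simp: Bochner_Integration.integral_sum)
qed

lemma has_integral_squared_residual:
  "integrable H (\<lambda>(x, y). (y - x \<bullet> \<beta>)\<^sup>2) \<and> (\<integral>(x, y). (y - x \<bullet> \<beta>)\<^sup>2 \<partial>H)
     = \<beta> \<bullet> (gram_matrix H *v \<beta>) - 2 * (cross_moment H \<bullet> \<beta>) + (\<integral>(x, y). y\<^sup>2 \<partial>H)"
proof -
  have eq: "(\<lambda>(x, y). (y - x \<bullet> \<beta>)\<^sup>2) = (\<lambda>p. (case p of (x, y) \<Rightarrow> (x \<bullet> \<beta>)\<^sup>2)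
      - 2 * (case p of (x, y) \<Rightarrow> (x \<bullet> \<beta>) * y) + (case p of (x, y) \<Rightarrow> y\<^sup>2))"
    by (auto simp: fun_eq_iff power2_eq_square algebra_simps)
  show ?thesis
    unfolding eq using has_integral_quadratic[of \<beta>] has_integral_covariate_inner_response[of \<beta>] response
    by simp
qed

lemma integral_covariate_residual:
  "(\<integral>(x, y). x $ i * (y - x \<bullet> \<beta>) \<partial>H) = (cross_moment H - gram_matrix H *v \<beta>) $ i"
proof -
  have eq: "(\<lambda>(x, y). x $ i * (y - x \<bullet> \<beta>)) = (\<lambda>p. (case p of (x, y) \<Rightarrow> x $ i * y)
      - (\<Sum>j\<in>UNIV. \<beta> $ j * (case p of (x, y) \<Rightarrow> x $ i * x $ j)))"
    by (auto simp: fun_eq_iff inner_vec_def sum_distrib_left algebra_simps)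
  have "(gram_matrix H *v \<beta>) $ i = (\<Sum>j\<in>UNIV. \<beta> $ j * (\<integral>(x, y). x $ i * x $ j \<partial>H))"
    unfolding matrix_vector_mult_def gram_matrix_def by (simp add: mult.commute)
  then show ?thesis
    unfolding eq using integrable_covariate_product integrable_covariate_response
    by (simp add: Bochner_Integration.integral_sum cross_moment_def)
qed

lemma gram_matrix_symmetric: "v \<bullet> (gram_matrix H *v w) = w \<bullet> (gram_matrix H *v v)"
proof -
  have "v \<bullet> (gram_matrix H *v w) = (\<Sum>i\<in>UNIV. \<Sum>j\<in>UNIV. gram_matrix H $ i $ j * (v $ i * w $ j))"
    by (simp add: inner_vec_def matrix_vector_mult_def sum_distrib_left mult_ac)
  also have "\<dots> = (\<Sum>i\<in>UNIV. \<Sum>j\<in>UNIV. gram_matrix H $ j $ i * (v $ j * w $ i))"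
    by (rule sum.swap)
  also have "\<dots> = (\<Sum>i\<in>UNIV. \<Sum>j\<in>UNIV. gram_matrix H $ i $ j * (w $ i * v $ j))"
    by (intro sum.cong refl) (simp add: gram_matrix_def mult.commute)
  also have "\<dots> = w \<bullet> (gram_matrix H *v v)"
    by (simp add: inner_vec_def matrix_vector_mult_def sum_distrib_left mult_ac)
  finally show ?thesis .
qed

lemma gram_matrix_psd: "0 \<le> v \<bullet> (gram_matrix H *v v)"
proof -
  have "0 \<le> (\<integral>(x, y). (x \<bullet> v)\<^sup>2 \<partial>H)" by (rule integral_nonneg_AE) auto
  then show ?thesis using has_integral_quadratic[of v] by simp
qed

lemma gram_contaminated_loss: "0 \<le> lam \<Longrightarrow> contaminated_loss (gram_matrix H) lam"
  by unfold_locales (use gram_matrix_symmetric gram_matrix_psd in auto)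

lemma penalized_objective_contaminate:
  assumes "0 \<le> \<epsilon>" "\<epsilon> \<le> 1" "0 \<le> lam"
  shows "penalized_objective J lam (contaminate \<epsilon> H (a, y\<^sub>0)) =
     contaminated_loss.objective (gram_matrix H) (cross_moment H) (\<integral>(x, y). y\<^sup>2 \<partial>H) lam a y\<^sub>0 \<epsilon> J"
proof -
  interpret contaminated_loss "gram_matrix H" "cross_moment H" "\<integral>(x, y). y\<^sup>2 \<partial>H" lam a y\<^sub>0
    using assms(3) by (rule gram_contaminated_loss)
  have "(a, y\<^sub>0) \<in> space H" using sets_eq_imp_space_eq[OF sets_H] by simp
  then have "(\<integral>(x, y). (y - x \<bullet> \<beta>)\<^sup>2 \<partial>contaminate \<epsilon> H (a, y\<^sub>0)) = loss \<epsilon> \<beta>" for \<beta>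
    using has_integral_squared_residual[of \<beta>] assms by (simp add: integral_contaminate loss_def)
  then show ?thesis by (simp add: fun_eq_iff penalized_objective_def objective_def)
qed

end

text \<open>
  Within \<open>{0..1}\<close> the point \<open>0\<close> can only be approached from the right.
\<close>

lemma has_vector_derivative_from_right:
  fixes f :: "real \<Rightarrow> 'b :: real_normed_vector"
  assumes "((\<lambda>\<epsilon>. (1 / \<epsilon>) *\<^sub>R (f \<epsilon> - f 0)) \<longlongrightarrow> v) (at_right 0)"
  shows "(f has_vector_derivative v) (at 0 within {0..1})"
proof -
  have "((\<lambda>\<epsilon>. (1 / \<epsilon>) *\<^sub>R (f \<epsilon> - f 0) - v) \<longlongrightarrow> 0) (at_right 0)"
    using assms by (rule LIM_zero)
  moreover have "\<forall>\<^sub>F \<epsilon> in at_right 0. (1 / \<epsilon>) *\<^sub>R (f \<epsilon> - f 0) - v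
      = (1 / norm (\<epsilon> - 0)) *\<^sub>R (f \<epsilon> - (f 0 + (\<epsilon> - 0) *\<^sub>R v))"
    using eventually_at_right_less[of 0] by eventually_elim (simp add: algebra_simps)
  ultimately have "((\<lambda>\<epsilon>. (1 / norm (\<epsilon> - 0)) *\<^sub>R (f \<epsilon> - (f 0 + (\<epsilon> - 0) *\<^sub>R v))) \<longlongrightarrow> 0) (at_right 0)"
    by (rule Lim_transform_eventually)
  then show ?thesis
    unfolding has_vector_derivative_def has_derivative_within
    by (simp add: at_within_Icc_at_right bounded_linear_scaleR_left)
qed

section \<open>The block formula\<close>

context unique_lasso begin

text \<open>
  The choice in \<open>inverse_upto\<close> is meaningful because the active block has an inverse, namely the active
  block of the inverse \<open>R\<close> of \<open>active_rows\<close>. Indeed \<open>active_rows\<close> is block triangular with an identity block, so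
  \<open>R\<close> vanishes at inactive rows and active columns, and the sums over all coordinates reduce to
  sums over the active ones.
\<close>

lemma inverse_upto_active_block:
  assumes c: "bij_betw c {1..CARD('p)} UNIV" and k: "k \<le> CARD('p)"
    and active: "\<And>j. j \<in> {1..CARD('p)} \<Longrightarrow> \<beta>s $ c j \<noteq> 0 \<longleftrightarrow> j \<le> k"
    and i: "i \<in> {1..k}" and j: "j \<in> {1..k}"
  shows "(\<Sum>l=1..k. A $ c i $ c l * inverse_upto k (\<lambda>i j. A $ c i $ c j) l j) = (if i = j then 1 else 0)"
proof -
  define G where "G = (\<lambda>i j. A $ c i $ c j)"
  obtain R where R: "active_rows ** R = mat 1" "R ** active_rows = mat 1"
    using invertible_if_trivial_kernel[OF active_rows_kernel] by (auto simp: invertible_def)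
  have inj: "c i = c j \<longleftrightarrow> i = j" if "i \<in> {1..k}" "j \<in> {1..k}" for i j
    using inj_on_eq_iff[OF bij_betw_imp_inj_on[OF c], of i j] that k by auto
  have split: "(\<Sum>m\<in>UNIV. f m) = (\<Sum>l=1..k. f (c l))" if "\<And>m. \<beta>s $ m = 0 \<Longrightarrow> f m = 0" for f :: "'p \<Rightarrow> real"
  proof -
    have "(\<Sum>m\<in>UNIV. f m) = (\<Sum>l=1..CARD('p). f (c l))"
      by (rule sum.reindex_bij_betw[OF c, symmetric])
    also have "\<dots> = (\<Sum>l=1..k. f (c l))"
    proof (rule sum.mono_neutral_right)
      show "\<forall>l\<in>{1..CARD('p)} - {1..k}. f (c l) = 0"
      proof
        fix l assume "l \<in> {1..CARD('p)} - {1..k}"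
        then show "f (c l) = 0" using active[of l] by (intro that) auto
      qed
    qed (use k in auto)
    finally show ?thesis .
  qed
  have act: "\<beta>s $ c i \<noteq> 0" if "i \<in> {1..k}" for i using that active[of i] k by auto
  have R0: "R $ m $ c j = 0" if "\<beta>s $ m = 0" "j \<in> {1..k}" for m j
  proof -
    have "R $ m $ c j = (active_rows ** R) $ m $ c j"
      using that(1) by (simp add: matrix_matrix_mult_def active_rows_def if_distrib[of "\<lambda>u. u * _"] cong: if_cong)
    also have "\<dots> = 0" unfolding R(1) using act[OF that(2)] that(1) by (auto simp: mat_def)
    finally show ?thesis .
  qed
  have "\<exists>B. \<forall>i\<in>{1..k}. \<forall>j\<in>{1..k}.
     (\<Sum>l=1..k. G i l * B l j) = (if i = j then 1 else 0) \<and>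
     (\<Sum>l=1..k. B i l * G l j) = (if i = j then 1 else 0)"
  proof (intro exI ballI conjI)
    fix i j assume ij: "i \<in> {1..k}" "j \<in> {1..k}"
    have "(\<Sum>l=1..k. G i l * R $ c l $ c j) = (\<Sum>m\<in>UNIV. A $ c i $ m * R $ m $ c j)"
      unfolding G_def by (rule split[symmetric]) (simp add: R0[OF _ ij(2)])
    also have "\<dots> = (active_rows ** R) $ c i $ c j"
      using act[OF ij(1)] by (simp add: matrix_matrix_mult_def active_rows_def)
    finally show "(\<Sum>l=1..k. G i l * R $ c l $ c j) = (if i = j then 1 else 0)"
      using inj[OF ij] by (simp add: R mat_def)
    have "(\<Sum>l=1..k. R $ c i $ c l * G l j) = (\<Sum>l=1..k. R $ c i $ c l * active_rows $ c l $ c j)"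
      by (intro sum.cong refl) (simp add: G_def active_rows_def act)
    also have "\<dots> = (\<Sum>m\<in>UNIV. R $ c i $ m * active_rows $ m $ c j)"
      using act[OF ij(2)] by (intro split[symmetric]) (auto simp: active_rows_def)
    also have "\<dots> = (R ** active_rows) $ c i $ c j"
      by (simp add: matrix_matrix_mult_def)
    finally show "(\<Sum>l=1..k. R $ c i $ c l * G l j) = (if i = j then 1 else 0)"
      using inj[OF ij] by (simp add: R mat_def)
  qed
  from someI_ex[OF this] i j show ?thesis
    unfolding inverse_upto_def[of k G, symmetric] by (simp add: G_def)
qed

text \<open>
  The vector of the block formula solves the \<open>active_rows\<close> system, by which it is determined.
\<close>

lemma block_solution:
  assumes c: "bij_betw c {1..CARD('p)} UNIV" and k: "k \<le> CARD('p)"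
    and active: "\<And>j. j \<in> {1..CARD('p)} \<Longrightarrow> \<beta>s $ c j \<noteq> 0 \<longleftrightarrow> j \<le> k"
    and h_def: "h = (\<Sum>i=1..k. (\<Sum>l=1..k. inverse_upto k (\<lambda>i j. A $ c i $ c j) i l * w l) *\<^sub>R axis (c i) (1 :: real))"
  shows "\<And>m. \<beta>s $ m = 0 \<Longrightarrow> h $ m = 0" and "\<And>i. i \<in> {1..k} \<Longrightarrow> (A *v h) $ c i = w i"
proof -
  let ?B = "inverse_upto k (\<lambda>i j. A $ c i $ c j)"
  have act: "\<beta>s $ c i \<noteq> 0" if "i \<in> {1..k}" for i using that active[of i] k by auto
  show "h $ m = 0" if "\<beta>s $ m = 0" for m
  proof -
    have "axis (c i) (1 :: real) $ m = 0" if "i \<in> {1..k}" for i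
      using act[OF that] \<open>\<beta>s $ m = 0\<close> by (auto simp: axis_def)
    then show ?thesis unfolding h_def sum_component vector_scaleR_component
      by (intro sum.neutral ballI) simp
  qed
  show "(A *v h) $ c i = w i" if i: "i \<in> {1..k}" for i
  proof -
    have "A *v h = (\<Sum>j=1..k. (\<Sum>l=1..k. ?B j l * w l) *\<^sub>R (A *v axis (c j) 1))"
      unfolding h_def
      by (simp add: linear_sum[OF matrix_vector_mul_linear] matrix_vector_mult_scaleR)
    then have "(A *v h) $ c i = (\<Sum>j=1..k. (\<Sum>l=1..k. ?B j l * w l) * A $ c i $ c j)"
      by (simp add: matrix_vector_mul_component inner_axis)
    also have "\<dots> = (\<Sum>j=1..k. \<Sum>l=1..k. A $ c i $ c j * ?B j l * w l)"
      by (simp add: sum_distrib_right sum_distrib_left mult_ac)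
    also have "\<dots> = (\<Sum>l=1..k. (\<Sum>j=1..k. A $ c i $ c j * ?B j l) * w l)"
      by (subst sum.swap) (simp add: sum_distrib_right)
    also have "\<dots> = (\<Sum>l=1..k. (if i = l then 1 else 0) * w l)"
      using inverse_upto_active_block[OF c k active i] by (intro sum.cong refl) simp
    also have "\<dots> = w i" using i by (simp add: if_distrib[of "\<lambda>u. u * _"] cong: if_cong)
    finally show ?thesis .
  qed
qed

end

section \<open>Convergence of the influence functions\<close>

theorem lemma5p4:
  fixes M :: "'a measure"
    and X :: "'a \<Rightarrow> real ^ 'p"
    and e y :: "'a \<Rightarrow> real"
    and \<beta>\<^sub>0 :: "real ^ 'p"
    and \<sigma> lam :: real
    and H\<^sub>0 :: "((real ^ 'p) \<times> real) measure"
    and c :: "nat \<Rightarrow> 'p"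
    and k :: nat
    and x\<^sub>0 :: "real ^ 'p"
    and y\<^sub>0 :: real
  assumes "prob_space M"
    and "X \<in> borel_measurable M"
    and "e \<in> borel_measurable M"
    and "integrable M (\<lambda>\<omega>. (norm (X \<omega>))\<^sup>2)"
    and "integrable M (\<lambda>\<omega>. (e \<omega>)\<^sup>2)"
    and "prob_space.indep_set M
           {X -` A \<inter> space M | A. A \<in> sets borel} {e -` A \<inter> space M | A. A \<in> sets borel}"
    and "prob_space.expectation M e = 0"
    and "distr M borel (\<lambda>\<omega>. - e \<omega>) = distr M borel e"
    and "prob_space.variance M e = \<sigma>\<^sup>2"
    and "y = (\<lambda>\<omega>. X \<omega> \<bullet> \<beta>\<^sub>0 + e \<omega>)"
    and "H\<^sub>0 = distr M borel (\<lambda>\<omega>. (X \<omega>, y \<omega>))"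
    and "lam \<ge> 0"
    and "\<exists>!\<beta>. is_arg_min (penalized_objective abs lam H\<^sub>0) (\<lambda>_. True) \<beta>"
    and "bij_betw c {1..CARD('p)} UNIV"
    and "k \<le> CARD('p)"
    and "\<forall>j\<in>{1..k}. lasso lam H\<^sub>0 $ c j \<noteq> 0"
    and "\<forall>j\<in>{k+1..CARD('p)}. lasso lam H\<^sub>0 $ c j = 0"
    and "lam = 0 \<longrightarrow> k = CARD('p)"
  shows "(\<forall>\<^sub>F K in at_top. has_influence_function (tanh_lasso K lam) H\<^sub>0 (x\<^sub>0, y\<^sub>0)
            (influence_function (tanh_lasso K lam) H\<^sub>0 (x\<^sub>0, y\<^sub>0))) \<and>
         ((\<lambda>K. influence_function (tanh_lasso K lam) H\<^sub>0 (x\<^sub>0, y\<^sub>0)) \<longlongrightarrow>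
            lasso_influence c k H\<^sub>0 (lasso lam H\<^sub>0) (x\<^sub>0, y\<^sub>0)) at_top \<and>
         ((\<forall>j\<in>{k+1..CARD('p)}.
             \<bar>\<integral>(x, y). x $ c j * (y - x \<bullet> lasso lam H\<^sub>0) \<partial>H\<^sub>0\<bar> < lam) \<longrightarrow>
          has_influence_function (lasso lam) H\<^sub>0 (x\<^sub>0, y\<^sub>0)
            (lasso_influence c k H\<^sub>0 (lasso lam H\<^sub>0) (x\<^sub>0, y\<^sub>0)))"
proof -
  note [measurable] = assms(2,3)
  have y [measurable]: "y \<in> borel_measurable M" unfolding assms(10) by measurable
  have XY: "(\<lambda>\<omega>. (X \<omega>, y \<omega>)) \<in> measurable M borel"
    unfolding borel_prod[symmetric] by measurable
  have sq: "square_integrable_law H\<^sub>0"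
  proof
    show "sets H\<^sub>0 = sets borel" by (simp add: assms(11))
    have meas: "(\<lambda>(x, y). (norm x)\<^sup>2) \<in> borel_measurable (borel :: ((real ^ 'p) \<times> real) measure)"
      "(\<lambda>(x, y). y\<^sup>2) \<in> borel_measurable (borel :: ((real ^ 'p) \<times> real) measure)"
      unfolding borel_prod[symmetric] by measurable
    show "integrable H\<^sub>0 (\<lambda>(x, y). (norm x)\<^sup>2)"
      unfolding assms(11) integrable_distr_eq[OF XY meas(1)] using assms(4) by simp
    have "integrable M (\<lambda>\<omega>. (y \<omega>)\<^sup>2)"
    proof (rule Bochner_Integration.integrable_bound)
      show "integrable M (\<lambda>\<omega>. 2 * ((norm \<beta>\<^sub>0)\<^sup>2 * (norm (X \<omega>))\<^sup>2 + (e \<omega>)\<^sup>2))"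
        using assms(4,5) by simp
      have "(X \<omega> \<bullet> \<beta>\<^sub>0 + e \<omega>)\<^sup>2 \<le> 2 * ((norm \<beta>\<^sub>0)\<^sup>2 * (norm (X \<omega>))\<^sup>2 + (e \<omega>)\<^sup>2)" for \<omega>
      proof -
        have "(X \<omega> \<bullet> \<beta>\<^sub>0 + e \<omega>)\<^sup>2 \<le> 2 * ((X \<omega> \<bullet> \<beta>\<^sub>0)\<^sup>2 + (e \<omega>)\<^sup>2)"
          using sum_squares_bound[of "X \<omega> \<bullet> \<beta>\<^sub>0" "e \<omega>"] by (simp add: power2_sum)
        moreover have "(X \<omega> \<bullet> \<beta>\<^sub>0)\<^sup>2 \<le> (norm \<beta>\<^sub>0)\<^sup>2 * (norm (X \<omega>))\<^sup>2"
        proof -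
          have "\<bar>X \<omega> \<bullet> \<beta>\<^sub>0\<bar>\<^sup>2 \<le> (norm (X \<omega>) * norm \<beta>\<^sub>0)\<^sup>2"
            by (intro power_mono Cauchy_Schwarz_ineq2) auto
          then show ?thesis by (simp add: power_mult_distrib mult.commute)
        qed
        ultimately show ?thesis by simp
      qed
      then show "AE \<omega> in M. norm ((y \<omega>)\<^sup>2) \<le> norm (2 * ((norm \<beta>\<^sub>0)\<^sup>2 * (norm (X \<omega>))\<^sup>2 + (e \<omega>)\<^sup>2))"
        by (auto simp: assms(10))
    qed measurable
    then show "integrable H\<^sub>0 (\<lambda>(x, y). y\<^sup>2)"
      unfolding assms(11) integrable_distr_eq[OF XY meas(2)] by simp
  qed
  interpret square_integrable_law H\<^sub>0 by (rule sq)
  define A where "A = gram_matrix H\<^sub>0"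
  define b where "b = cross_moment H\<^sub>0"
  define \<kappa> where "\<kappa> = (\<integral>(x, y). y\<^sup>2 \<partial>H\<^sub>0)"
  define \<beta>s where "\<beta>s = lasso lam H\<^sub>0"
  interpret contaminated_loss A b \<kappa> lam x\<^sub>0 y\<^sub>0
    unfolding A_def using assms(12) by (rule gram_contaminated_loss)
  have po: "penalized_objective J lam (contaminate \<epsilon> H\<^sub>0 (x\<^sub>0, y\<^sub>0)) = objective \<epsilon> J"
    if "0 \<le> \<epsilon>" "\<epsilon> \<le> 1" for J \<epsilon>
    unfolding A_def b_def \<kappa>_def using that assms(12) by (rule penalized_objective_contaminate)
  have po0: "penalized_objective J lam H\<^sub>0 = objective 0 J" for J
    using po[of 0 J] by (simp add: contaminate_0)
  have ind: "\<beta>s $ c j \<noteq> 0 \<longleftrightarrow> j \<le> k" if "j \<in> {1..CARD('p)}" for j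
    using that assms(16,17) by (cases "j \<le> k") (auto simp: \<beta>s_def)
  have onto: "\<exists>j\<in>{1..CARD('p)}. m = c j" for m
    using bij_betw_imp_surj_on[OF assms(14)] by (metis UNIV_I imageE)
  interpret unique_lasso A b \<kappa> lam x\<^sub>0 y\<^sub>0 \<beta>s
  proof
    have "is_arg_min (objective 0 abs) (\<lambda>_. True) \<beta>s"
      unfolding \<beta>s_def lasso_def arg_min_def po0
      using assms(13)[unfolded po0] by (auto intro: someI_ex)
    then show "objective 0 abs \<beta>s < objective 0 abs \<beta>" if "\<beta> \<noteq> \<beta>s" for \<beta>
      using assms(13)[unfolded po0] that unfolding is_arg_min_def
      by (metis not_less_iff_gr_or_eq)
    show "\<beta>s $ j \<noteq> 0" if "lam = 0" for j
      using onto[of j] ind assms(18) that by auto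
  qed
  define h where "h = lasso_influence c k H\<^sub>0 \<beta>s (x\<^sub>0, y\<^sub>0)"
  have h_eq: "h = (\<Sum>i=1..k. (\<Sum>l=1..k. inverse_upto k (\<lambda>i j. A $ c i $ c j) i l
      * score_shift \<beta>s $ c l) *\<^sub>R axis (c i) (1 :: real))"
  proof -
    have "(\<lambda>i j. \<integral>(x, y). x $ c i * x $ c j \<partial>H\<^sub>0) = (\<lambda>i j. A $ c i $ c j)"
      by (simp add: A_def gram_matrix_def)
    moreover have "x\<^sub>0 $ c l * (y\<^sub>0 - x\<^sub>0 \<bullet> \<beta>s) - (b - A *v \<beta>s) $ c l = score_shift \<beta>s $ c l" for l
      by (simp add: score_shift_def)
    ultimately show ?thesis
      unfolding h_def lasso_influence_def Let_def integral_covariate_residual A_def[symmetric] b_def[symmetric]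
      by (simp only: fst_conv snd_conv)
  qed
  have h: "\<And>m. \<beta>s $ m = 0 \<Longrightarrow> h $ m = 0" "\<And>m. \<beta>s $ m \<noteq> 0 \<Longrightarrow> (A *v h) $ m = score_shift \<beta>s $ m"
  proof -
    show "h $ m = 0" if "\<beta>s $ m = 0" for m
      by (rule block_solution(1)[OF assms(14,15) _ h_eq that]) (rule ind)
    have "(A *v h) $ c i = score_shift \<beta>s $ c i" if "i \<in> {1..k}" for i
      by (rule block_solution(2)[OF assms(14,15) _ h_eq that]) (rule ind)
    then show "(A *v h) $ m = score_shift \<beta>s $ m" if "\<beta>s $ m \<noteq> 0" for m
      using onto[of m] ind that by auto
  qed
  have tanh: "tanh_lasso K lam (contaminate \<epsilon> H\<^sub>0 (x\<^sub>0, y\<^sub>0)) = tanh_minimizer K \<epsilon>"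
    if "0 \<le> \<epsilon>" "\<epsilon> \<le> 1" for K \<epsilon>
    unfolding tanh_lasso_def tanh_minimizer_def po[OF that] ..
  have las: "lasso lam (contaminate \<epsilon> H\<^sub>0 (x\<^sub>0, y\<^sub>0)) = lasso_minimizer \<epsilon>"
    if "0 \<le> \<epsilon>" "\<epsilon> \<le> 1" for \<epsilon>
    unfolding lasso_def lasso_minimizer_def po[OF that] ..
  have influence: "has_influence_function T H\<^sub>0 (x\<^sub>0, y\<^sub>0) v"
    if T: "\<And>\<epsilon>. 0 \<le> \<epsilon> \<Longrightarrow> \<epsilon> \<le> 1 \<Longrightarrow> T (contaminate \<epsilon> H\<^sub>0 (x\<^sub>0, y\<^sub>0)) = f \<epsilon>"
      and lim: "((\<lambda>\<epsilon>. (1 / \<epsilon>) *\<^sub>R (f \<epsilon> - f 0)) \<longlongrightarrow> v) (at_right 0)" for T f and v :: "real ^ 'p"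
  proof -
    have "(f has_vector_derivative v) (at 0 within {0..1})"
      using lim by (rule has_vector_derivative_from_right)
    then show ?thesis
      unfolding has_influence_function_def
      by (rule has_vector_derivative_transform[rotated 2]) (auto simp: T)
  qed
  have if_eq: "influence_function T H\<^sub>0 (x\<^sub>0, y\<^sub>0) = v"
    if "has_influence_function T H\<^sub>0 (x\<^sub>0, y\<^sub>0) v" for T and v :: "real ^ 'p"
    using that unfolding influence_function_def has_influence_function_def
    by (intro vector_derivative_within) (auto simp: at_within_Icc_at_right)
  let ?IF = "\<lambda>K. influence_function (tanh_lasso K lam) H\<^sub>0 (x\<^sub>0, y\<^sub>0)"
  have ev: "\<forall>\<^sub>F K in at_top. has_influence_function (tanh_lasso K lam) H\<^sub>0 (x\<^sub>0, y\<^sub>0) (?IF K) \<and>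
      (\<forall>j. (A *v ?IF K) $ j + lam * tanh_penalty_deriv2 K (tanh_minimizer K 0 $ j) * ?IF K $ j
        = score_shift (tanh_minimizer K 0) $ j)"
    using tanh_influence_exists
  proof eventually_elim
    case (elim K)
    then obtain v where v: "\<forall>j. (A *v v) $ j + lam * tanh_penalty_deriv2 K (tanh_minimizer K 0 $ j) * v $ j
        = score_shift (tanh_minimizer K 0) $ j"
      "((\<lambda>\<epsilon>. (1 / \<epsilon>) *\<^sub>R (tanh_minimizer K \<epsilon> - tanh_minimizer K 0)) \<longlongrightarrow> v) (at_right 0)" by blast
    have "has_influence_function (tanh_lasso K lam) H\<^sub>0 (x\<^sub>0, y\<^sub>0) v"
      by (rule influence[where f = "tanh_minimizer K", OF _ v(2)]) (rule tanh)
    with if_eq[OF this] v(1) show ?case by simp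
  qed
  have "(?IF \<longlongrightarrow> h) at_top"
    by (rule tanh_influence_tendsto[OF _ h]) (use ev in \<open>auto elim: eventually_mono\<close>)
  moreover have "has_influence_function (lasso lam) H\<^sub>0 (x\<^sub>0, y\<^sub>0) h"
    if strict: "\<forall>j\<in>{k+1..CARD('p)}. \<bar>\<integral>(x, y). x $ c j * (y - x \<bullet> lasso lam H\<^sub>0) \<partial>H\<^sub>0\<bar> < lam"
  proof (rule influence[where f = lasso_minimizer])
    show "lasso lam (contaminate \<epsilon> H\<^sub>0 (x\<^sub>0, y\<^sub>0)) = lasso_minimizer \<epsilon>"
      if "0 \<le> \<epsilon>" "\<epsilon> \<le> 1" for \<epsilon> using that by (rule las)
    have "\<bar>score 0 \<beta>s $ m\<bar> < lam" if "\<beta>s $ m = 0" for m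
    proof -
      obtain j where j: "j \<in> {1..CARD('p)}" "m = c j" using onto by blast
      then have "j \<in> {k+1..CARD('p)}" using ind[OF j(1)] that by auto
      then have "\<bar>(b - A *v \<beta>s) $ m\<bar> < lam"
        using strict j(2)
        unfolding integral_covariate_residual A_def[symmetric] b_def[symmetric] \<beta>s_def[symmetric] by simp
      then show ?thesis by (simp add: score_def)
    qed
    then show "((\<lambda>\<epsilon>. (1 / \<epsilon>) *\<^sub>R (lasso_minimizer \<epsilon> - lasso_minimizer 0)) \<longlongrightarrow> h) (at_right 0)"
      unfolding lasso_minimizer_0 by (rule difference_quotient_lasso[OF _ h])
  qed
  moreover have "\<forall>\<^sub>F K in at_top. has_influence_function (tanh_lasso K lam) H\<^sub>0 (x\<^sub>0, y\<^sub>0) (?IF K)"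
    using ev by eventually_elim simp
  ultimately show ?thesis unfolding h_def \<beta>s_def by blast
qed

end
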